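(* Let $\xi\in\partial\mathbb B$ and let $f$ be a slice regular function on $\mathbb B\cup[\xi]$ such that $f(\mathbb B)\subseteq\mathbb B$ and $f(\xi)\in\partial\mathbb B$. Then: (i) It holds that $$\overline{\xi}\Big(f(\xi)\overline{f'(\xi)}+\big[\overline{\xi},f(\xi)\overline{R_{\overline{\xi}}R_{\xi}f(\xi)}\,\big]\Big)\geq\frac{2\big(1-|f(0)|\big)^2}{1-|f(0)|^2+|f'(0)|}.$$ (ii) If further $f^{(k)}(0)=0$ for all $k=0,1,\ldots,n-1$ for some $n\in\mathbb N$, then $$\overline{\xi}\Big(f(\xi)\overline{f'(\xi)}+\big[\overline{\xi},f(\xi)\overline{R_{\overline{\xi}}R_{\xi}f(\xi)}\,\big]\Big)\geq n+\frac{2\big(1-|f^{(n)}(0)|/n!\big)^2}{1-\big|f^{(n)}(0)/n!\big|^2+|f^{(n+1)}(0)|/(n+1)!}.$$ In particular, $$\overline{\xi}\Big(f(\xi)\overline{f'(\xi)}+\big[\overline{\xi},f(\xi)\overline{R_{\overline{\xi}}R_{\xi}f(\xi)}\,\big]\Big)>n$$ unless $f(q)=q^nu$ for some $u\in\partial\mathbb B$.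
   Context: $\mathbb H$ is the algebra of quaternions, $\mathbb B=\{q\in\mathbb H:|q|<1\}$, $\mathbb S=\{q\in\mathbb H:q^2=-1\}$, and $\mathbb C_I=\mathbb R\oplus I\mathbb R$ for $I\in\mathbb S$. A function $f$ on a domain $\Omega\subseteq\mathbb H$ is slice regular if for every $I\in\mathbb S$ its restriction $f_I$ to $\Omega\cap\mathbb C_I$ has continuous partial derivatives and satisfies $\frac12\left(\frac{\partial}{\partial x}+I\frac{\partial}{\partial y}\right)f_I(x+yI)=0$. The slice derivative is $f'(x+yI)=\frac12\left(\frac{\partial}{\partial x}-I\frac{\partial}{\partial y}\right)f_I(x+yI)$, again slice regular, and $f^{(n)}$ is its $n$-th iterate. A domain $\Omega$ is an axially symmetric slice domain if it meets $\mathbb R$, $\Omega\cap\mathbb C_I$ is a domain of $\mathbb C_I$ for every $I\in\mathbb S$, and $x+yI\in\Omega$ ($x,y\in\mathbb R$, $I\in\mathbb S$) implies $x+y\mathbb S\subseteq\Omega$. $[\xi]=\{q\xi q^{-1}:q\in\mathbb H\setminus\{0\}\}$. "Slice regular on $\mathbb B\cup[\xi]$" means: slice regular on some axially symmetric slice domain containing $\mathbb B\cup[\xi]$. For quaternions $a,b$, $[a,b]=ab-ba$. For $f$ slice regular on an axially symmetric slice domain $\Omega$ and $\xi\in\Omega$, $R_\xi f(q):=(q-\xi)^{-\ast}\ast\big(f(q)-f(\xi)\big)$ is the unique slice regular function on $\Omega$ with $f(q)-f(\xi)=(q-\xi)\ast R_\xi f(q)$, where $\ast$ is the regular product (for power series,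 $\sum q^na_n\ast\sum q^nb_n=\sum q^n\sum_{k=0}^na_kb_{n-k}$); for $\xi\ne0$ and $h$ slice regular on $\Omega$, $(q-\xi)\ast h(q)=q\,h(q)-\xi\,h(\xi^{-1}q\xi)$. $R_{\overline\xi}R_\xi f(\xi)$ is the value at $\xi$ of $R_{\overline\xi}(R_\xi f)$. An inequality between a quaternion and a real number asserts that the quaternion is real and the inequality holds. The displayed lower bound with a fraction in (ii) is understood when the denominator is nonzero (it vanishes only if $f(q)=q^nu$ with $|u|=1$). *)

theory Defs
  imports "HOL-Analysis.Analysis"
begin

section \<open>Quaternions\<close>

datatype quat = Quat (qRe: real) (qIm1: real) (qIm2: real) (qIm3: real)

lemma quat_eq_iff:
  "p = q \<longleftrightarrow> qRe p = qRe q \<and> qIm1 p = qIm1 q \<and> qIm2 p = qIm2 q \<and> qIm3 p = qIm3 q"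
  by (cases p; cases q) auto

instantiation quat :: real_vector
begin

definition zero_quat :: quat where "0 = Quat 0 0 0 0"
definition plus_quat :: "quat \<Rightarrow> quat \<Rightarrow> quat" where
  "p + q = Quat (qRe p + qRe q) (qIm1 p + qIm1 q) (qIm2 p + qIm2 q) (qIm3 p + qIm3 q)"
definition uminus_quat :: "quat \<Rightarrow> quat" where
  "- q = Quat (- qRe q) (- qIm1 q) (- qIm2 q) (- qIm3 q)"
definition minus_quat :: "quat \<Rightarrow> quat \<Rightarrow> quat" where
  "p - q = Quat (qRe p - qRe q) (qIm1 p - qIm1 q) (qIm2 p - qIm2 q) (qIm3 p - qIm3 q)"
definition scaleR_quat :: "real \<Rightarrow> quat \<Rightarrow> quat" where
  "r *\<^sub>R q = Quat (r * qRe q) (r * qIm1 q) (r * qIm2 q) (r * qIm3 q)"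

instance
  by standard
    (simp_all add: quat_eq_iff zero_quat_def plus_quat_def uminus_quat_def minus_quat_def
      scaleR_quat_def algebra_simps)

end

lemma quat_add_sel [simp]:
  "qRe (p + q) = qRe p + qRe q" "qIm1 (p + q) = qIm1 p + qIm1 q"
  "qIm2 (p + q) = qIm2 p + qIm2 q" "qIm3 (p + q) = qIm3 p + qIm3 q"
  by (simp_all add: plus_quat_def)

lemma quat_diff_sel [simp]:
  "qRe (p - q) = qRe p - qRe q" "qIm1 (p - q) = qIm1 p - qIm1 q"
  "qIm2 (p - q) = qIm2 p - qIm2 q" "qIm3 (p - q) = qIm3 p - qIm3 q"
  by (simp_all add: minus_quat_def)

lemma quat_uminus_sel [simp]:
  "qRe (- q) = - qRe q" "qIm1 (- q) = - qIm1 q"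
  "qIm2 (- q) = - qIm2 q" "qIm3 (- q) = - qIm3 q"
  by (simp_all add: uminus_quat_def)

lemma quat_scaleR_sel [simp]:
  "qRe (r *\<^sub>R q) = r * qRe q" "qIm1 (r *\<^sub>R q) = r * qIm1 q"
  "qIm2 (r *\<^sub>R q) = r * qIm2 q" "qIm3 (r *\<^sub>R q) = r * qIm3 q"
  by (simp_all add: scaleR_quat_def)

lemma quat_zero_sel [simp]: "qRe 0 = 0" "qIm1 0 = 0" "qIm2 0 = 0" "qIm3 0 = 0"
  by (simp_all add: zero_quat_def)

instantiation quat :: "{real_algebra_1, division_ring}"
begin

definition one_quat :: quat where "1 = Quat 1 0 0 0"
definition times_quat :: "quat \<Rightarrow> quat \<Rightarrow> quat" where
  "p * q = Quat
     (qRe p * qRe q - qIm1 p * qIm1 q - qIm2 p * qIm2 q - qIm3 p * qIm3 q)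
     (qRe p * qIm1 q + qIm1 p * qRe q + qIm2 p * qIm3 q - qIm3 p * qIm2 q)
     (qRe p * qIm2 q - qIm1 p * qIm3 q + qIm2 p * qRe q + qIm3 p * qIm1 q)
     (qRe p * qIm3 q + qIm1 p * qIm2 q - qIm2 p * qIm1 q + qIm3 p * qRe q)"
definition inverse_quat :: "quat \<Rightarrow> quat" where
  "inverse q = (1 / ((qRe q)\<^sup>2 + (qIm1 q)\<^sup>2 + (qIm2 q)\<^sup>2 + (qIm3 q)\<^sup>2)) *\<^sub>R
     Quat (qRe q) (- qIm1 q) (- qIm2 q) (- qIm3 q)"
definition divide_quat :: "quat \<Rightarrow> quat \<Rightarrow> quat" where
  "divide_quat p q = p * inverse q"

lemma quat_normsq_pos:
  assumes "q \<noteq> (0 :: quat)"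
  shows "(qRe q)\<^sup>2 + (qIm1 q)\<^sup>2 + (qIm2 q)\<^sup>2 + (qIm3 q)\<^sup>2 > 0"
proof -
  have "qRe q \<noteq> 0 \<or> qIm1 q \<noteq> 0 \<or> qIm2 q \<noteq> 0 \<or> qIm3 q \<noteq> 0"
    using assms by (auto simp: quat_eq_iff)
  then show ?thesis
    by (smt (verit) zero_less_power2 zero_le_power2)
qed

instance
proof
  fix q :: quat
  assume "q \<noteq> 0"
  then have *: "(qRe q)\<^sup>2 + (qIm1 q)\<^sup>2 + (qIm2 q)\<^sup>2 + (qIm3 q)\<^sup>2 \<noteq> 0"
    using quat_normsq_pos by force
  show "inverse q * q = 1"
    using * unfolding quat_eq_iff inverse_quat_def times_quat_def one_quat_def
    by (simp add: scaleR_quat_def divide_simps) (simp add: power2_eq_square algebra_simps)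
  show "q * inverse q = 1"
    using * unfolding quat_eq_iff inverse_quat_def times_quat_def one_quat_def
    by (simp add: scaleR_quat_def divide_simps) (simp add: power2_eq_square algebra_simps)
qed (simp_all add: quat_eq_iff one_quat_def times_quat_def divide_quat_def inverse_quat_def
      zero_quat_def algebra_simps)

end

lemma quat_times_sel [simp]:
  "qRe (p * q) = qRe p * qRe q - qIm1 p * qIm1 q - qIm2 p * qIm2 q - qIm3 p * qIm3 q"
  "qIm1 (p * q) = qRe p * qIm1 q + qIm1 p * qRe q + qIm2 p * qIm3 q - qIm3 p * qIm2 q"
  "qIm2 (p * q) = qRe p * qIm2 q - qIm1 p * qIm3 q + qIm2 p * qRe q + qIm3 p * qIm1 q"
  "qIm3 (p * q) = qRe p * qIm3 q + qIm1 p * qIm2 q - qIm2 p * qIm1 q + qIm3 p * qRe q"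
  by (simp_all add: times_quat_def)

lemma quat_one_sel [simp]: "qRe 1 = 1" "qIm1 1 = 0" "qIm2 1 = 0" "qIm3 1 = 0"
  by (simp_all add: one_quat_def)

lemma quat_of_real_sel [simp]:
  "qRe (of_real r) = r" "qIm1 (of_real r) = 0" "qIm2 (of_real r) = 0" "qIm3 (of_real r) = 0"
  by (simp_all add: of_real_def)

instantiation quat :: real_inner
begin

definition inner_quat :: "quat \<Rightarrow> quat \<Rightarrow> real" where
  "inner_quat p q = qRe p * qRe q + qIm1 p * qIm1 q + qIm2 p * qIm2 q + qIm3 p * qIm3 q"
definition norm_quat :: "quat \<Rightarrow> real" where
  "norm q = sqrt ((qRe q)\<^sup>2 + (qIm1 q)\<^sup>2 + (qIm2 q)\<^sup>2 + (qIm3 q)\<^sup>2)"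
definition sgn_quat :: "quat \<Rightarrow> quat" where
  "sgn (q :: quat) = q /\<^sub>R norm q"
definition dist_quat :: "quat \<Rightarrow> quat \<Rightarrow> real" where
  "dist (p :: quat) q = norm (p - q)"
definition uniformity_quat :: "(quat \<times> quat) filter" where
  "uniformity = (INF e\<in>{0<..}. principal {(x :: quat, y). dist x y < e})"
definition open_quat :: "quat set \<Rightarrow> bool" where
  "open (U :: quat set) \<longleftrightarrow> (\<forall>x\<in>U. eventually (\<lambda>(x', y). x' = x \<longrightarrow> y \<in> U) uniformity)"

instance
proof
  fix p q r :: quat and a :: real and U :: "quat set"
  show "dist p q = norm (p - q)" by (rule dist_quat_def)
  show "sgn q = q /\<^sub>R norm q" by (rule sgn_quat_def)
  show "uniformity = (INF e\<in>{0<..}. principal {(x :: quat, y). dist x y < e})"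
    by (rule uniformity_quat_def)
  show "open U \<longleftrightarrow> (\<forall>x\<in>U. eventually (\<lambda>(x', y). x' = x \<longrightarrow> y \<in> U) uniformity)"
    by (rule open_quat_def)
  show "inner p q = inner q p" "inner (p + q) r = inner p r + inner q r"
    "inner (a *\<^sub>R p) q = a * inner p q" "0 \<le> inner p p"
    by (simp_all add: inner_quat_def algebra_simps)
  show "inner p p = 0 \<longleftrightarrow> p = 0"
    using quat_normsq_pos[of p] by (cases "p = 0") (auto simp: inner_quat_def power2_eq_square)
  show "norm p = sqrt (inner p p)"
    by (simp add: norm_quat_def inner_quat_def power2_eq_square)
qed

end

instance quat :: real_normed_div_algebra
proof
  fix p q :: quat
  show "norm (p * q) = norm p * norm q"
    unfolding norm_quat_def real_sqrt_mult[symmetric]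
    by (simp add: power2_eq_square algebra_simps)
qed

instantiation quat :: euclidean_space
begin

definition Basis_quat :: "quat set" where
  "Basis = {Quat 1 0 0 0, Quat 0 1 0 0, Quat 0 0 1 0, Quat 0 0 0 1}"

instance
proof
  fix u v x :: quat
  show "(Basis :: quat set) \<noteq> {}" "finite (Basis :: quat set)"
    by (simp_all add: Basis_quat_def)
  show "inner u v = (if u = v then 1 else 0)" if "u \<in> Basis" "v \<in> Basis"
  proof -
    have "u = Quat 1 0 0 0 \<or> u = Quat 0 1 0 0 \<or> u = Quat 0 0 1 0 \<or> u = Quat 0 0 0 1"
      "v = Quat 1 0 0 0 \<or> v = Quat 0 1 0 0 \<or> v = Quat 0 0 1 0 \<or> v = Quat 0 0 0 1"
      using that by (simp_all add: Basis_quat_def)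
    then show ?thesis
      unfolding inner_quat_def by (elim disjE) simp_all
  qed
  show "(\<forall>u\<in>Basis. inner x u = 0) \<longleftrightarrow> x = 0"
    unfolding Basis_quat_def inner_quat_def quat_eq_iff[of x] by simp
qed

end

definition qcnj :: "quat \<Rightarrow> quat" where
  "qcnj q = Quat (qRe q) (- qIm1 q) (- qIm2 q) (- qIm3 q)"

definition qVec :: "quat \<Rightarrow> quat" where
  "qVec q = Quat 0 (qIm1 q) (qIm2 q) (qIm3 q)"

definition qcomm :: "quat \<Rightarrow> quat \<Rightarrow> quat" where
  "qcomm a b = a * b - b * a"

text \<open>An order relation between a quaternion and a real number includes the assertion that the
  quaternion is real.\<close>

definition quat_ge :: "quat \<Rightarrow> real \<Rightarrow> bool" where
  "quat_ge q r \<longleftrightarrow> q \<in> \<real> \<and> qRe q \<ge> r"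

definition quat_gt :: "quat \<Rightarrow> real \<Rightarrow> bool" where
  "quat_gt q r \<longleftrightarrow> q \<in> \<real> \<and> qRe q > r"

section \<open>Slice domains\<close>

definition imag_units :: "quat set" where
  "imag_units = {q. q\<^sup>2 = -1}"

definition slice_pt :: "quat \<Rightarrow> real \<Rightarrow> real \<Rightarrow> quat" where
  "slice_pt I x y = of_real x + of_real y * I"

definition slice_plane :: "quat \<Rightarrow> quat set" where
  "slice_plane I = {slice_pt I x y | x y. True}"

definition conj_class :: "quat \<Rightarrow> quat set" where
  "conj_class \<xi> = {q * \<xi> * inverse q | q. q \<noteq> 0}"

definition axially_symmetric_slice_domain :: "quat set \<Rightarrow> bool" where
  "axially_symmetric_slice_domain \<Omega> \<longleftrightarrow>
     open \<Omega> \<and> connected \<Omega> \<and> \<Omega> \<inter> \<real> \<noteq> {} \<and>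
     (\<forall>I\<in>imag_units. openin (top_of_set (slice_plane I)) (\<Omega> \<inter> slice_plane I) \<and>
        connected (\<Omega> \<inter> slice_plane I)) \<and>
     (\<forall>x y. \<forall>I\<in>imag_units. slice_pt I x y \<in> \<Omega> \<longrightarrow> (\<forall>J\<in>imag_units. slice_pt J x y \<in> \<Omega>))"

section \<open>Slice regular functions\<close>

definition slice_dx :: "(quat \<Rightarrow> quat) \<Rightarrow> quat \<Rightarrow> real \<Rightarrow> real \<Rightarrow> quat" where
  "slice_dx f I x y = vector_derivative (\<lambda>t. f (slice_pt I t y)) (at x)"

definition slice_dy :: "(quat \<Rightarrow> quat) \<Rightarrow> quat \<Rightarrow> real \<Rightarrow> real \<Rightarrow> quat" where
  "slice_dy f I x y = vector_derivative (\<lambda>t. f (slice_pt I x t)) (at y)"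

definition slice_regular_on :: "(quat \<Rightarrow> quat) \<Rightarrow> quat set \<Rightarrow> bool" where
  "slice_regular_on f \<Omega> \<longleftrightarrow>
     (\<forall>I\<in>imag_units.
        (\<forall>x y. slice_pt I x y \<in> \<Omega> \<longrightarrow>
           (\<lambda>t. f (slice_pt I t y)) differentiable (at x) \<and>
           (\<lambda>t. f (slice_pt I x t)) differentiable (at y)) \<and>
        continuous_on {(x, y). slice_pt I x y \<in> \<Omega>} (\<lambda>(x, y). slice_dx f I x y) \<and>
        continuous_on {(x, y). slice_pt I x y \<in> \<Omega>} (\<lambda>(x, y). slice_dy f I x y) \<and>
        (\<forall>x y. slice_pt I x y \<in> \<Omega> \<longrightarrow>
           (1/2) *\<^sub>R (slice_dx f I x y + I * slice_dy f I x y) = 0))"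

text \<open>A point \<open>q\<close> has several representations \<open>x + yI\<close> (two if \<open>q\<close> is not real, and one for each
  \<open>I\<close> if it is real); at the points of an open set where \<open>f\<close> is slice regular, all of them give
  the same derivative.\<close>

definition slice_deriv :: "(quat \<Rightarrow> quat) \<Rightarrow> quat \<Rightarrow> quat" where
  "slice_deriv f q = (THE d. \<forall>x y. \<forall>I\<in>imag_units. q = slice_pt I x y \<longrightarrow>
     d = (1/2) *\<^sub>R (slice_dx f I x y - I * slice_dy f I x y))"

section \<open>The regular product and the difference quotients\<close>

text \<open>On an axially symmetric slice domain a slice regular function has the form
  \<open>f (x + yI) = b x y + I * c x y\<close> with \<open>b\<close> and \<open>c\<close> independent of the imaginary unit \<open>I\<close>
  (representation formula), so that \<open>b\<close> and \<open>c\<close> can be read off on the slice of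
  \<open>J = Quat 0 1 0 0\<close>. The regular product multiplies these forms as if \<open>I\<close> commuted with
  \<open>b\<close> and \<open>c\<close>.\<close>

definition stem1 :: "(quat \<Rightarrow> quat) \<Rightarrow> real \<Rightarrow> real \<Rightarrow> quat" where
  "stem1 f x y = (let J = Quat 0 1 0 0 in
     (1/2) *\<^sub>R (f (slice_pt J x y) + f (slice_pt J x (- y))))"

definition stem2 :: "(quat \<Rightarrow> quat) \<Rightarrow> real \<Rightarrow> real \<Rightarrow> quat" where
  "stem2 f x y = (let J = Quat 0 1 0 0 in
     - (1/2) *\<^sub>R (J * (f (slice_pt J x y) - f (slice_pt J x (- y)))))"

text \<open>At a real point \<open>q\<close> the imaginary unit \<open>sgn (qVec q)\<close> degenerates to \<open>0\<close>, which is harmless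
  because the factor following it vanishes there.\<close>

definition regular_prod :: "(quat \<Rightarrow> quat) \<Rightarrow> (quat \<Rightarrow> quat) \<Rightarrow> quat \<Rightarrow> quat"
    (infixl \<open>\<star>\<close> 70) where
  "(f \<star> g) q = (let x = qRe q; y = norm (qVec q); I = sgn (qVec q) in
     (stem1 f x y * stem1 g x y - stem2 f x y * stem2 g x y) +
     I * (stem1 f x y * stem2 g x y + stem2 f x y * stem1 g x y))"

text \<open>The clause outside \<open>\<Omega>\<close> only serves to make a function on \<open>\<Omega>\<close> unique as a total function.\<close>

definition diff_quot :: "quat set \<Rightarrow> quat \<Rightarrow> (quat \<Rightarrow> quat) \<Rightarrow> quat \<Rightarrow> quat" where
  "diff_quot \<Omega> \<xi> f = (THE h. slice_regular_on h \<Omega> \<and>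
     (\<forall>q\<in>\<Omega>. f q - f \<xi> = ((\<lambda>p. p - \<xi>) \<star> h) q) \<and> (\<forall>q. q \<notin> \<Omega> \<longrightarrow> h q = 0))"

definition boundary_expr :: "quat set \<Rightarrow> quat \<Rightarrow> (quat \<Rightarrow> quat) \<Rightarrow> quat" where
  "boundary_expr \<Omega> \<xi> f =
     qcnj \<xi> * (f \<xi> * qcnj (slice_deriv f \<xi>) +
       qcomm (qcnj \<xi>) (f \<xi> * qcnj (diff_quot \<Omega> (qcnj \<xi>) (diff_quot \<Omega> \<xi> f) \<xi>)))"

subsection \<open>Agreement with the usual formulas\<close>

lemma imag_units_iff:
  "I \<in> imag_units \<longleftrightarrow> qRe I = 0 \<and> (qIm1 I)\<^sup>2 + (qIm2 I)\<^sup>2 + (qIm3 I)\<^sup>2 = 1"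
proof
  assume "I \<in> imag_units"
  then have eq: "(qRe I)\<^sup>2 - (qIm1 I)\<^sup>2 - (qIm2 I)\<^sup>2 - (qIm3 I)\<^sup>2 = -1"
    "qRe I * qIm1 I = 0" "qRe I * qIm2 I = 0" "qRe I * qIm3 I = 0"
    by (auto simp: imag_units_def quat_eq_iff power2_eq_square)
  have "qRe I = 0"
  proof (rule ccontr)
    assume "qRe I \<noteq> 0"
    then have "(qRe I)\<^sup>2 = -1" using eq by simp
    then show False using zero_le_power2[of "qRe I"] by linarith
  qed
  then show "qRe I = 0 \<and> (qIm1 I)\<^sup>2 + (qIm2 I)\<^sup>2 + (qIm3 I)\<^sup>2 = 1"
    using eq by simp
next
  assume "qRe I = 0 \<and> (qIm1 I)\<^sup>2 + (qIm2 I)\<^sup>2 + (qIm3 I)\<^sup>2 = 1"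
  then show "I \<in> imag_units"
    by (auto simp: imag_units_def quat_eq_iff power2_eq_square)
qed

lemma imag_unit_square: "I \<in> imag_units \<Longrightarrow> I * I = -1"
  by (simp add: imag_units_def power2_eq_square)

lemma i_imag_unit: "Quat 0 1 0 0 \<in> imag_units"
  by (simp add: imag_units_iff)

lemma of_real_commute_quat: "of_real r * (q :: quat) = q * of_real r"
  by (simp add: quat_eq_iff)

lemma quat_slice_form:
  obtains I where "I \<in> imag_units" "q = slice_pt I (qRe q) (norm (qVec q))"
    "qVec q \<noteq> 0 \<Longrightarrow> I = sgn (qVec q)"
proof (cases "qVec q = 0")
  case True
  then have "q = slice_pt (Quat 0 1 0 0) (qRe q) (norm (qVec q))"
    by (simp add: slice_pt_def) (simp add: quat_eq_iff qVec_def)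
  then show ?thesis
    using that[OF i_imag_unit] True by simp
next
  case False
  define n where "n = norm (qVec q)"
  have n: "n > 0" "n\<^sup>2 = (qIm1 q)\<^sup>2 + (qIm2 q)\<^sup>2 + (qIm3 q)\<^sup>2"
    using False by (simp add: n_def) (simp add: n_def norm_quat_def qVec_def)
  have s: "sgn (qVec q) = inverse n *\<^sub>R qVec q"
    by (simp add: sgn_quat_def n_def)
  have "qIm1 q ^ 2 / n ^ 2 + qIm2 q ^ 2 / n ^ 2 + qIm3 q ^ 2 / n ^ 2 = n ^ 2 / n ^ 2"
    by (simp only: n(2) add_divide_distrib)
  then have "sgn (qVec q) \<in> imag_units"
    using n(1) unfolding imag_units_iff s
    by (simp add: qVec_def power_mult_distrib power_inverse divide_inverse mult.commute)
  moreover have "q = slice_pt (sgn (qVec q)) (qRe q) (norm (qVec q))"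
    using n(1) unfolding s slice_pt_def n_def[symmetric] by (simp add: quat_eq_iff qVec_def)
  ultimately show ?thesis
    using that by simp
qed

lemma stem_eq:
  assumes "\<And>I. I \<in> imag_units \<Longrightarrow> f (slice_pt I x y) = b + I * c"
  shows "stem1 f x y = b" "stem2 f x y = c"
proof -
  have "- Quat 0 1 0 0 \<in> imag_units" "slice_pt (- Quat 0 1 0 0) x y = slice_pt (Quat 0 1 0 0) x (- y)"
    by (simp_all add: imag_units_iff slice_pt_def)
  with assms[OF i_imag_unit] assms[of "- Quat 0 1 0 0"]
  have f: "f (slice_pt (Quat 0 1 0 0) x y) = b + Quat 0 1 0 0 * c"
    "f (slice_pt (Quat 0 1 0 0) x (- y)) = b - Quat 0 1 0 0 * c"
    by simp_all
  show "stem1 f x y = b"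
    by (simp add: stem1_def f flip: scaleR_2)
  have "Quat 0 1 0 0 * (Quat 0 1 0 0 * c) = - c"
    using imag_unit_square[OF i_imag_unit] by (metis mult.assoc mult_minus1)
  then show "stem2 f x y = c"
    unfolding stem2_def Let_def f by (simp add: distrib_left flip: scaleR_2)
qed

lemma regular_prod_slice_form:
  assumes f: "\<And>I. I \<in> imag_units \<Longrightarrow> f (slice_pt I (qRe q) (norm (qVec q))) = b + I * c"
    and g: "\<And>I. I \<in> imag_units \<Longrightarrow> g (slice_pt I (qRe q) (norm (qVec q))) = b' + I * c'"
    and I: "I \<in> imag_units" "q = slice_pt I (qRe q) (norm (qVec q))"
      "qVec q \<noteq> 0 \<Longrightarrow> I = sgn (qVec q)"
  shows "(f \<star> g) q = (b * b' - c * c') + I * (b * c' + c * b')"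
proof (cases "qVec q = 0")
  case True
  have "stem2 h x 0 = 0" for h x
    by (simp add: stem2_def)
  then have "c = 0" "c' = 0"
    using stem_eq(2)[OF f] stem_eq(2)[OF g] True by (metis norm_zero)+
  then show ?thesis
    by (simp add: regular_prod_def Let_def stem_eq[OF f] stem_eq[OF g])
next
  case False
  then show ?thesis
    using I(3) by (simp add: regular_prod_def Let_def stem_eq[OF f] stem_eq[OF g])
qed

lemma linear_regular_prod:
  assumes "\<xi> \<noteq> 0"
    and h: "\<And>I. I \<in> imag_units \<Longrightarrow> h (slice_pt I (qRe q) (norm (qVec q))) = b + I * c"
  shows "((\<lambda>p. p - \<xi>) \<star> h) q = q * h q - \<xi> * h (inverse \<xi> * q * \<xi>)"
proof -
  obtain I where I: "I \<in> imag_units" "q = slice_pt I (qRe q) (norm (qVec q))"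
      "qVec q \<noteq> 0 \<Longrightarrow> I = sgn (qVec q)"
    using quat_slice_form by blast
  define x y where "x = qRe q" and "y = norm (qVec q)"
  have lin: "slice_pt K x y - \<xi> = (of_real x - \<xi>) + K * of_real y" for K
    by (simp add: slice_pt_def of_real_commute_quat)
  have q: "q = of_real x + of_real y * I"
    using I(2) by (simp add: slice_pt_def x_def y_def)
  have hq: "h q = b + I * c"
    using h[OF I(1)] I(2) by simp
  have K: "inverse \<xi> * I * \<xi> \<in> imag_units"
  proof -
    have "(inverse \<xi> * I * \<xi>) * (inverse \<xi> * I * \<xi>) = inverse \<xi> * I * (\<xi> * inverse \<xi>) * I * \<xi>"
      by (simp only: mult.assoc)
    also have "\<dots> = inverse \<xi> * (I * I) * \<xi>"
      using assms(1) by (simp add: mult.assoc)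
    finally show ?thesis
      using assms(1) by (simp add: imag_units_def power2_eq_square imag_unit_square[OF I(1)])
  qed
  have "inverse \<xi> * q * \<xi> = of_real x * (inverse \<xi> * \<xi>) + of_real y * (inverse \<xi> * I * \<xi>)"
    unfolding q by (simp add: distrib_left distrib_right of_real_commute_quat mult.assoc)
  then have "inverse \<xi> * q * \<xi> = slice_pt (inverse \<xi> * I * \<xi>) x y"
    using assms(1) by (simp add: slice_pt_def)
  then have h': "h (inverse \<xi> * q * \<xi>) = b + inverse \<xi> * I * \<xi> * c"
    using h[OF K] by (simp add: x_def y_def)
  have "((\<lambda>p. p - \<xi>) \<star> h) q =
      ((of_real x - \<xi>) * b - of_real y * c) + I * ((of_real x - \<xi>) * c + of_real y * b)"
    by (rule regular_prod_slice_form[OF _ h I]) (simp_all add: lin x_def[symmetric] y_def[symmetric])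
  also have "\<dots> = q * (b + I * c) - (\<xi> * b + I * \<xi> * c)"
  proof -
    have "I * (of_real x * c) = of_real x * (I * c)" "I * (of_real y * b) = of_real y * (I * b)"
      by (metis mult.assoc of_real_commute_quat)+
    moreover have "of_real y * I * (I * c) = - (of_real y * c)"
      using imag_unit_square[OF I(1)] by (metis mult.assoc mult_minus1 mult_minus_right)
    ultimately show ?thesis
      unfolding q by (simp add: distrib_left distrib_right left_diff_distrib right_diff_distrib mult.assoc)
  qed
  also have "\<xi> * b + I * \<xi> * c = \<xi> * (b + inverse \<xi> * I * \<xi> * c)"
  proof -
    have "\<xi> * (inverse \<xi> * I * \<xi> * c) = (\<xi> * inverse \<xi>) * I * \<xi> * c"
      by (simp only: mult.assoc)
    then show ?thesis
      using assms(1) by (simp add: distrib_left)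
  qed
  finally show ?thesis
    by (simp add: hq h')
qed

lemma power_slice_form:
  obtains u v :: real where "\<And>I. I \<in> imag_units \<Longrightarrow> slice_pt I x y ^ n = of_real u + of_real v * I"
proof -
  have "\<exists>u v :: real. \<forall>I\<in>imag_units. slice_pt I x y ^ n = of_real u + of_real v * I"
  proof (induction n)
    case 0
    show ?case
      by (rule exI[of _ 1], rule exI[of _ 0]) simp
  next
    case (Suc n)
    then obtain u v :: real where uv: "\<forall>I\<in>imag_units. slice_pt I x y ^ n = of_real u + of_real v * I"
      by blast
    have "slice_pt I x y ^ Suc n = of_real (x * u - y * v) + of_real (x * v + y * u) * I"
      if I: "I \<in> imag_units" for I
    proof -
      have "qRe I = 0" "qIm1 I * qIm1 I + qIm2 I * qIm2 I + qIm3 I * qIm3 I = 1"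
        using I by (auto simp: imag_units_iff power2_eq_square)
      moreover from this(2) have "y * v * (qIm1 I * qIm1 I) + y * v * (qIm2 I * qIm2 I) + y * v * (qIm3 I * qIm3 I) = y * v"
        by (metis distrib_left mult.right_neutral)
      ultimately show ?thesis
        using uv I by (simp add: slice_pt_def quat_eq_iff algebra_simps)
    qed
    then show ?case by blast
  qed
  then show ?thesis
    using that by blast
qed

lemma monomial_regular_prod: "(\<lambda>q. q ^ m * a) \<star> (\<lambda>q. q ^ n * b) = (\<lambda>q. q ^ (m + n) * (a * b))"
proof
  fix q
  obtain I where I: "I \<in> imag_units" "q = slice_pt I (qRe q) (norm (qVec q))"
      "qVec q \<noteq> 0 \<Longrightarrow> I = sgn (qVec q)"
    using quat_slice_form by blast
  obtain u v :: real where uv: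
    "\<And>I. I \<in> imag_units \<Longrightarrow> slice_pt I (qRe q) (norm (qVec q)) ^ m = of_real u + of_real v * I"
    using power_slice_form by blast
  obtain s t :: real where st:
    "\<And>I. I \<in> imag_units \<Longrightarrow> slice_pt I (qRe q) (norm (qVec q)) ^ n = of_real s + of_real t * I"
    using power_slice_form by blast
  have "((\<lambda>q. q ^ m * a) \<star> (\<lambda>q. q ^ n * b)) q =
      (of_real u * a * (of_real s * b) - of_real v * a * (of_real t * b)) +
      I * (of_real u * a * (of_real t * b) + of_real v * a * (of_real s * b))"
    by (rule regular_prod_slice_form[OF _ _ I])
      (simp_all add: uv st distrib_left distrib_right mult.assoc,
       metis mult.assoc of_real_commute_quat, metis mult.assoc of_real_commute_quat)
  also have "\<dots> = (of_real (u * s - v * t) + of_real (u * t + v * s) * I) * (a * b)"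
    by (simp add: quat_eq_iff algebra_simps)
  also have "of_real (u * s - v * t) + of_real (u * t + v * s) * I =
      (of_real u + of_real v * I) * (of_real s + of_real t * I)"
  proof -
    have "of_real v * I * (of_real t * I) = of_real (v * t) * (I * I)"
      by (simp add: mult.assoc) (metis mult.assoc of_real_commute_quat)
    then have "of_real v * I * (of_real t * I) = - of_real (v * t)"
      by (simp add: imag_unit_square[OF I(1)])
    moreover have "of_real v * I * of_real s = of_real (v * s) * I"
      by (simp add: mult.assoc of_real_commute_quat[of s I, symmetric])
    ultimately show ?thesis
      by (simp add: distrib_left distrib_right mult.assoc of_real_commute_quat[of s I])
  qed
  also have "\<dots> = q ^ (m + n)"
    using uv[OF I(1)] st[OF I(1)] I(2) by (simp add: power_add)
  finally show "((\<lambda>q. q ^ m * a) \<star> (\<lambda>q. q ^ n * b)) q = q ^ (m + n) * (a * b)" .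
qed

end

theory Submission
  imports Defs "HOL-Complex_Analysis.Complex_Analysis"
begin

text \<open>
The bracketed expression, complicated as it looks, is the derivative of \<open>norm f\<close> at \<open>\<xi>\<close> in the
radial direction; once this is known, the statement is a classical one about a single holomorphic
function on the disc.

Write \<open>\<xi> = x + y * P\<close> with an imaginary unit \<open>P\<close> and let \<open>a = f \<xi>\<close>. On the slice of \<open>P\<close>, the Hermitian product
\<open>h\<close> of \<open>f\<close> with \<open>a\<close> is a holomorphic self-map of the disc with boundary value \<open>1\<close> at the point \<open>\<zeta>\<close> that
corresponds to \<open>\<xi>\<close>. The number \<open>\<zeta> * deriv h \<zeta>\<close> is real, because \<open>norm h\<close> is maximal at \<open>\<zeta>\<close> along the
circle. For the quaternion \<open>u = slice_deriv f \<xi> * qcnj a\<close> this says that the part of \<open>\<xi> * u\<close> in the slice is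
real; call it \<open>\<lambda>\<close>.

The commutator takes care of the part orthogonal to the slice. On the sphere \<open>x + y * K\<close>, where \<open>K\<close> runs through
the imaginary units, \<open>f\<close> is \<open>b + K * c\<close> by the representation formula, with
\<open>c = y * R\<close> and \<open>R\<close> the value of the first difference quotient at \<open>qcnj \<xi>\<close>. Since \<open>norm f \<le> 1\<close> on that sphere
with equality at \<open>K = P\<close>, the quaternion \<open>R * qcnj a\<close> must lie in the slice of \<open>P\<close>
(\<open>qRe_maximal_imp_commute\<close>). The first difference quotient takes the value \<open>slice_deriv f \<xi>\<close> at \<open>\<xi>\<close>, and the
second one measures the difference of these two values. So the commutator is minus the
orthogonal part of \<open>qcnj u\<close>, and the whole expression equals \<open>\<lambda>\<close> (\<open>boundary_identity\<close>,
\<open>boundary_expr_eq_radial_derivative\<close>). At a real point \<open>\<xi>\<close> the commutator is zero, and there is no orthogonal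
part, because \<open>\<xi>\<close> lies on every slice.

The lower bounds for \<open>\<lambda>\<close> are those of Osserman's boundary Schwarz lemma for \<open>h\<close>
(\<open>boundary_schwarz_osserman\<close>). The Taylor coefficients of \<open>h\<close> at \<open>0\<close> are at most those of \<open>f\<close> in norm, and the
bound is a decreasing function of them (\<open>osserman_bound_antimono\<close>). If \<open>\<lambda> = n\<close>, then \<open>h\<close> is a
unimodular multiple of \<open>z ^ n\<close>; as \<open>norm f \<le> norm z ^ n\<close>, the function \<open>f\<close> itself is a monomial on the slice,
and then everywhere by the identity principle.

The difference quotients and the slice derivative are governed by
\<open>slice_regular_iff_holomorphic\<close>, which expresses slice regularity through complex coordinates, and by the fact that a
holomorphic map on one slice extends to a slice regular function (\<open>slice_regular_slice_ext\<close>).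
\<close>

section \<open>The boundary Schwarz lemma on the unit disc\<close>

text \<open>Dividing a self-map of the disc by a power of the variable only yields a map into the closed
  disc. By the maximum principle such a map misses the unit circle unless it is a constant on it;
  that constant is the extremal case of every estimate below.\<close>

lemma disc_map_less_or_const:
  assumes holh: "h holomorphic_on ball 0 1" and le: "\<And>z. norm z < 1 \<Longrightarrow> norm (h z) \<le> 1"
  obtains "\<And>z. norm z < 1 \<Longrightarrow> norm (h z) < 1"
  | c where "norm c = 1" "\<And>z. norm z < 1 \<Longrightarrow> h z = c"
proof (cases "\<exists>z. norm z < 1 \<and> norm (h z) = 1")
  case True
  then obtain z0 where z0: "norm z0 < 1" "norm (h z0) = 1" by blast
  have "h constant_on ball 0 1"
    by (rule maximum_modulus_principle[OF holh open_ball connected_ball open_ball order_refl, of z0])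
      (use z0 le in auto)
  then obtain c where "\<And>z. norm z < 1 \<Longrightarrow> h z = c"
    by (auto simp: constant_on_def)
  then show ?thesis using z0 that(2)[of c] by metis
next
  case False
  then show ?thesis using le that(1) by (metis less_eq_real_def)
qed

text \<open>The Schwarz lemma bounds the quotient by \<open>1\<close>. The relation between the derivatives at \<open>0\<close> says that
  division by the variable shifts the Taylor coefficients by one place.\<close>

lemma disc_map_factor:
  assumes holh: "h holomorphic_on ball 0 1" and le: "\<And>z. norm z < 1 \<Longrightarrow> norm (h z) \<le> 1"
    and h0: "h 0 = 0"
  obtains g where "g holomorphic_on ball 0 1" "\<And>z. norm z < 1 \<Longrightarrow> norm (g z) \<le> 1"
    "\<And>z. norm z < 1 \<Longrightarrow> h z = z * g z"
    "\<And>k. (deriv ^^ Suc k) h 0 = of_nat (Suc k) * (deriv ^^ k) g 0"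
proof -
  have lt: "norm (h z) < 1" if "norm z < 1" for z
    using disc_map_less_or_const[OF holh le] h0 that
    by (metis norm_zero zero_less_one zero_neq_one)
  obtain g where g: "g holomorphic_on ball 0 1" "\<And>z. norm z < 1 \<Longrightarrow> h z = z * g z" "deriv h 0 = g 0"
    by (rule Schwarz3[OF holh h0]) auto
  have "norm (g z) \<le> 1" if z: "norm z < 1" for z
  proof (cases "z = 0")
    case True
    then show ?thesis
      using Schwarz_Lemma(2)[OF holh h0 lt z] g(3) by simp
  next
    case False
    have "norm z * norm (g z) \<le> norm z * 1"
      using Schwarz_Lemma(1)[OF holh h0 lt z] g(2)[OF z] by (simp add: norm_mult)
    then show ?thesis using False by (metis mult_le_cancel_left_pos zero_less_norm_iff)
  qed
  moreover have "(deriv ^^ Suc k) h 0 = of_nat (Suc k) * (deriv ^^ k) g 0" for k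
  proof -
    have "(deriv ^^ Suc k) h 0 = (deriv ^^ Suc k) (\<lambda>w. w * g w) 0"
      by (rule higher_deriv_transform_within_open[of _ "ball 0 1"])
        (auto intro!: holomorphic_intros holh g(1) simp: g(2))
    also have "\<dots> = (\<Sum>i=0..Suc k. of_nat (Suc k choose i) * (deriv ^^ i) (\<lambda>w. w) 0 * (deriv ^^ (Suc k - i)) g 0)"
      by (rule higher_deriv_mult[of _ "ball 0 1"]) (auto intro!: holomorphic_intros g(1))
    also have "\<dots> = (\<Sum>i\<in>{1}. of_nat (Suc k choose i) * (deriv ^^ i) (\<lambda>w. w) 0 * (deriv ^^ (Suc k - i)) g 0)"
      by (rule sum.mono_neutral_right) auto
    finally show ?thesis by simp
  qed
  ultimately show ?thesis using that[OF g(1)] g(2) by blast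
qed

text \<open>Removing a zero of order \<open>n\<close> at the origin turns the \<open>n\<close>-th and the next Taylor coefficient into the
  value and the derivative of the cofactor, so that estimates in terms of the first two coefficients
  suffice.\<close>

lemma disc_map_factor_power:
  assumes "h holomorphic_on ball 0 1" "\<And>z. norm z < 1 \<Longrightarrow> norm (h z) \<le> 1"
    and "\<And>k. k < n \<Longrightarrow> (deriv ^^ k) h 0 = 0"
  shows "\<exists>g. g holomorphic_on ball 0 1 \<and> (\<forall>z. norm z < 1 \<longrightarrow> norm (g z) \<le> 1) \<and>
    (\<forall>z. norm z < 1 \<longrightarrow> h z = z ^ n * g z) \<and>
    (\<forall>k. (deriv ^^ k) g 0 / fact k = (deriv ^^ (n + k)) h 0 / fact (n + k))"
  using assms
proof (induction n arbitrary: h)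
  case 0
  then show ?case by (intro exI[of _ h]) auto
next
  case (Suc n)
  have "h 0 = 0" using Suc.prems(3)[of 0] by simp
  from disc_map_factor[OF Suc.prems(1,2) this]
  obtain g where g: "g holomorphic_on ball 0 1" "\<And>z. norm z < 1 \<Longrightarrow> norm (g z) \<le> 1"
    "\<And>z. norm z < 1 \<Longrightarrow> h z = z * g z"
    "\<And>k. (deriv ^^ Suc k) h 0 = of_nat (Suc k) * (deriv ^^ k) g 0"
    by metis
  have "(deriv ^^ k) g 0 = 0" if "k < n" for k
    using g(4)[of k] Suc.prems(3)[of "Suc k"] that by (simp del: funpow.simps of_nat_Suc)
  from Suc.IH[OF g(1,2) this]
  obtain G where G: "G holomorphic_on ball 0 1" "\<forall>z. norm z < 1 \<longrightarrow> norm (G z) \<le> 1"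
    "\<forall>z. norm z < 1 \<longrightarrow> g z = z ^ n * G z"
    "\<forall>k. (deriv ^^ k) G 0 / fact k = (deriv ^^ (n + k)) g 0 / fact (n + k)"
    by blast
  have "(deriv ^^ k) G 0 / fact k = (deriv ^^ (Suc n + k)) h 0 / fact (Suc n + k)" for k
    unfolding G(4)[rule_format] add_Suc g(4) fact_Suc
    by (simp del: of_nat_Suc)
  then show ?case
    using G g(3) by (intro exI[of _ G]) auto
qed

text \<open>Among the points of a pseudohyperbolic disc of radius \<open>m\<close> about \<open>c\<close>, the one of largest modulus lies on
  the ray through \<open>c\<close>: after squaring, the only term depending on the direction of \<open>w\<close> is
  \<open>Re (cnj c * w)\<close>, and it is at most \<open>norm c * norm w\<close>.\<close>

lemma mobius_modulus_bound:
  fixes w c :: complex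
  assumes "norm w \<le> 1" "norm c \<le> 1" "0 \<le> m" "m \<le> 1"
    and le: "norm (w - c) \<le> m * norm (1 - cnj c * w)"
  shows "norm w * (1 + m * norm c) \<le> norm c + m"
proof -
  let ?x = "Re (cnj c * w)"
  have x: "?x \<le> norm c * norm w"
    using complex_Re_le_cmod[of "cnj c * w"] by (simp add: norm_mult)
  have 1: "(norm (w - c))\<^sup>2 = (norm w)\<^sup>2 + (norm c)\<^sup>2 - 2 * ?x"
    unfolding cmod_power2 by (simp add: power2_eq_square algebra_simps)
  have 2: "(norm (1 - cnj c * w))\<^sup>2 = 1 + (norm c)\<^sup>2 * (norm w)\<^sup>2 - 2 * ?x"
    unfolding cmod_power2 by (simp add: power2_eq_square algebra_simps)
  have "(norm (w - c))\<^sup>2 \<le> m\<^sup>2 * (norm (1 - cnj c * w))\<^sup>2"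
    using power_mono[OF le, of 2] by (simp add: power_mult_distrib)
  then have "(norm w)\<^sup>2 + (norm c)\<^sup>2 - m\<^sup>2 * (1 + (norm c)\<^sup>2 * (norm w)\<^sup>2) \<le> 2 * (1 - m\<^sup>2) * ?x"
    unfolding 1 2 by (simp add: algebra_simps)
  also have "\<dots> \<le> 2 * (1 - m\<^sup>2) * (norm c * norm w)"
    using x assms(3,4) by (intro mult_left_mono) (auto simp: power_le_one)
  finally have "(norm w - norm c)\<^sup>2 \<le> (m * (1 - norm c * norm w))\<^sup>2"
    by (simp add: power2_eq_square algebra_simps)
  moreover have "0 \<le> m * (1 - norm c * norm w)"
    using assms by (simp add: mult_le_one)
  ultimately have "norm w - norm c \<le> m * (1 - norm c * norm w)"
    by (rule power2_le_imp_le)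
  then show ?thesis by (simp add: algebra_simps)
qed

text \<open>Composing with the disc automorphism that sends \<open>g 0\<close> to \<open>0\<close> produces a zero at the origin that can be
  divided out. The value at \<open>0\<close> of the cofactor \<open>k\<close> is, up to a rotation, the hyperbolic
  derivative of \<open>g\<close> there, which brings \<open>deriv g 0\<close> into the estimates.\<close>

lemma disc_map_mobius:
  assumes holg: "g holomorphic_on ball 0 1" and lt: "\<And>z. norm z < 1 \<Longrightarrow> norm (g z) < 1"
  obtains k where "k holomorphic_on ball 0 1" "\<And>z. norm z < 1 \<Longrightarrow> norm (k z) \<le> 1"
    "\<And>z. norm z < 1 \<Longrightarrow> g z - g 0 = z * k z * (1 - cnj (g 0) * g z)"
    "norm (deriv g 0) = norm (k 0) * (1 - (norm (g 0))\<^sup>2)"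
proof -
  let ?M = "\<lambda>z. Moebius_function 0 (g 0) (g z)"
  have g0: "norm (g 0) < 1" using lt by simp
  have img: "g ` ball 0 1 \<subseteq> ball 0 1" using lt by auto
  have hol: "?M holomorphic_on ball 0 1"
    using holomorphic_on_compose_gen[OF holg Moebius_function_holomorphic[OF g0, of 0] img]
    by (simp add: o_def)
  have le: "norm (?M z) \<le> 1" if "norm z < 1" for z
    using Moebius_function_norm_lt_1[OF g0 lt[OF that]] by (simp add: less_imp_le)
  obtain k where k: "k holomorphic_on ball 0 1" "\<And>z. norm z < 1 \<Longrightarrow> norm (k z) \<le> 1"
    "\<And>z. norm z < 1 \<Longrightarrow> ?M z = z * k z"
    using disc_map_factor[OF hol le] by (metis Moebius_function_eq_zero)
  have nz: "1 - cnj (g 0) * g z \<noteq> 0" if "norm z < 1" for z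
  proof
    assume "1 - cnj (g 0) * g z = 0"
    then have "norm (g 0) * norm (g z) = 1"
      by (metis complex_mod_cnj eq_iff_diff_eq_0 norm_mult norm_one)
    moreover have "norm (g 0) * norm (g z) < 1 * 1"
      using g0 lt[OF that] by (intro mult_strict_mono') auto
    ultimately show False by simp
  qed
  have eq: "g z - g 0 = z * k z * (1 - cnj (g 0) * g z)" if "norm z < 1" for z
    using k(3)[OF that] nz[OF that] by (simp add: Moebius_function_simple field_simps)
  have "(g has_field_derivative deriv g 0) (at 0)" "(k has_field_derivative deriv k 0) (at 0)"
    using holg k(1) by (auto intro!: holomorphic_derivI[where S = "ball 0 1"])
  then have "((\<lambda>z. g z - g 0 - z * k z * (1 - cnj (g 0) * g z)) has_field_derivative
      (deriv g 0 - k 0 * (1 - cnj (g 0) * g 0))) (at 0)"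
    by (auto intro!: derivative_eq_intros)
  moreover have "((\<lambda>z. g z - g 0 - z * k z * (1 - cnj (g 0) * g z)) has_field_derivative 0) (at 0)"
    proof (rule has_field_derivative_transform_within_open[where S="ball 0 1" and f="\<lambda>_. 0"])
    show "0 = g z - g 0 - z * k z * (1 - cnj (g 0) * g z)" if "z \<in> ball 0 1" for z
      using eq[of z] that by simp
  qed auto
  ultimately have "deriv g 0 - k 0 * (1 - cnj (g 0) * g 0) = 0"
    by (rule DERIV_unique)
  moreover have "1 - cnj (g 0) * g 0 = of_real (1 - (norm (g 0))\<^sup>2)"
    by (simp only: complex_norm_square of_real_diff of_real_1 mult.commute)
  ultimately have "deriv g 0 = k 0 * of_real (1 - (norm (g 0))\<^sup>2)" by simp
  then have "norm (deriv g 0) = norm (k 0) * \<bar>1 - (norm (g 0))\<^sup>2\<bar>"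
    by (simp only: norm_mult norm_of_real)
  moreover have "(norm (g 0))\<^sup>2 \<le> 1" using g0 by (simp add: power_le_one)
  ultimately show ?thesis using that[OF k(1,2) eq] by simp
qed

lemma schwarz_pick_origin:
  assumes holg: "g holomorphic_on ball 0 1" and le: "\<And>z. norm z < 1 \<Longrightarrow> norm (g z) \<le> 1"
    and z: "norm z < 1"
  shows "norm (g z) * (1 + norm z * norm (g 0)) \<le> norm (g 0) + norm z"
proof (rule disc_map_less_or_const[OF holg le])
  assume lt: "\<And>z. norm z < 1 \<Longrightarrow> norm (g z) < 1"
  obtain k where k: "\<And>z. norm z < 1 \<Longrightarrow> norm (k z) \<le> 1"
    "\<And>z. norm z < 1 \<Longrightarrow> g z - g 0 = z * k z * (1 - cnj (g 0) * g z)"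
    using disc_map_mobius[OF holg lt] by metis
  have "norm (g z - g 0) \<le> norm z * norm (1 - cnj (g 0) * g z)"
    unfolding k(2)[OF z] norm_mult
    using k(1)[OF z] by (intro mult_right_mono) (auto simp: mult_left_le)
  then show ?thesis
    using le[of 0] le[OF z] z by (intro mobius_modulus_bound) auto
next
  fix c assume "norm c = 1" "\<And>z. norm z < 1 \<Longrightarrow> g z = c"
  then show ?thesis using z by simp
qed

text \<open>This is a Schwarz-Pick estimate of second order: the cofactor \<open>k\<close> of the automorphism is again a map
  into the closed disc, so it is bounded in terms of \<open>k 0\<close>, and inserting that bound for \<open>k\<close> into the
  one for \<open>g\<close> measures how far \<open>g z\<close> stays from the circle. The factors
  \<open>1 + r * \<tau>\<close> and \<open>1 + m * s\<close> are replaced by their values at the boundary, \<open>1 + \<tau>\<close> and \<open>1 + s\<close>; this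
  costs nothing in the limit and leaves a bound that is polynomial in \<open>norm z\<close>.\<close>

lemma disc_map_boundary_gap:
  assumes holg: "g holomorphic_on ball 0 1" and lt: "\<And>z. norm z < 1 \<Longrightarrow> norm (g z) < 1"
    and z: "norm z < 1"
  shows "(1 - norm (g 0))\<^sup>2 * (1 - (norm z)\<^sup>2)
    \<le> (1 - norm (g z)) * (1 - (norm (g 0))\<^sup>2 + norm (deriv g 0))"
proof -
  obtain k where k: "k holomorphic_on ball 0 1" "\<And>z. norm z < 1 \<Longrightarrow> norm (k z) \<le> 1"
    "\<And>z. norm z < 1 \<Longrightarrow> g z - g 0 = z * k z * (1 - cnj (g 0) * g z)"
    "norm (deriv g 0) = norm (k 0) * (1 - (norm (g 0))\<^sup>2)"
    using disc_map_mobius[OF holg lt] by metis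
  define s \<tau> r m where "s = norm (g 0)" and "\<tau> = norm (k 0)" and "r = norm z"
    and "m = norm z * norm (k z)"
  have s: "0 \<le> s" "s < 1" and \<tau>: "0 \<le> \<tau>" "\<tau> \<le> 1" and r: "0 \<le> r" "r < 1" and m: "0 \<le> m" "m \<le> 1"
    using lt[of 0] k(2)[of 0] k(2)[OF z] z by (auto simp: s_def \<tau>_def r_def m_def intro: mult_le_one)
  have "m * (1 + r * \<tau>) \<le> r * (\<tau> + r)"
    using mult_left_mono[OF schwarz_pick_origin[OF k(1,2) z], of r]
    unfolding m_def \<tau>_def r_def by (simp add: algebra_simps)
  then have "1 - r\<^sup>2 \<le> (1 - m) * (1 + r * \<tau>)"
    by (simp add: algebra_simps power2_eq_square)
  also have "\<dots> \<le> (1 - m) * (1 + \<tau>)"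
    using m r \<tau> by (intro mult_left_mono) (auto simp: mult_left_le_one_le)
  finally have 1: "1 - r\<^sup>2 \<le> (1 - m) * (1 + \<tau>)" .
  have "norm (g z - g 0) = m * norm (1 - cnj (g 0) * g z)"
    unfolding k(3)[OF z] norm_mult m_def by simp
  then have "norm (g z) * (1 + m * s) \<le> s + m"
    unfolding s_def using lt[of 0] lt[OF z] m by (intro mobius_modulus_bound) auto
  then have "(1 - s) * (1 - m) \<le> (1 - norm (g z)) * (1 + m * s)"
    by (simp add: algebra_simps)
  also have "\<dots> \<le> (1 - norm (g z)) * (1 + s)"
    using m s lt[OF z] by (intro mult_left_mono) (auto simp: mult_left_le_one_le)
  finally have 2: "(1 - s) * (1 - m) \<le> (1 - norm (g z)) * (1 + s)" .
  have "(1 - s)\<^sup>2 * (1 - r\<^sup>2) \<le> (1 - s)\<^sup>2 * ((1 - m) * (1 + \<tau>))"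
    using 1 by (intro mult_left_mono) auto
  also have "\<dots> = ((1 - s) * (1 - m)) * ((1 - s) * (1 + \<tau>))"
    by (simp add: power2_eq_square)
  also have "\<dots> \<le> ((1 - norm (g z)) * (1 + s)) * ((1 - s) * (1 + \<tau>))"
    using 2 s \<tau> by (intro mult_right_mono) auto
  also have "\<dots> = (1 - norm (g z)) * (1 - s\<^sup>2 + \<tau> * (1 - s\<^sup>2))"
    by (simp add: power2_eq_square algebra_simps)
  finally show ?thesis unfolding k(4) s_def \<tau>_def r_def .
qed

lemma disc_bound_extends:
  fixes h :: "complex \<Rightarrow> complex"
  assumes cont: "continuous_on S h" and S: "ball 0 1 \<subseteq> S" and le: "\<And>z. norm z < 1 \<Longrightarrow> norm (h z) \<le> 1"
    and w: "w \<in> S" "norm w \<le> 1"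
  shows "norm (h w) \<le> 1"
proof (cases "norm w < 1")
  case False
  have "w \<in> closure (ball 0 1)" using w by simp
  then obtain X where X: "\<And>n. X n \<in> ball 0 1" "X \<longlonglongrightarrow> w"
    unfolding closure_sequential by blast
  have "(\<lambda>n. h (X n)) \<longlonglongrightarrow> h w"
    by (rule continuous_on_tendsto_compose[OF cont X(2) w(1)]) (use X S in \<open>auto intro!: always_eventually\<close>)
  then have "(\<lambda>n. norm (h (X n))) \<longlonglongrightarrow> norm (h w)"
    by (rule tendsto_norm)
  then show ?thesis
    by (rule LIMSEQ_le_const2) (use X(1) le in auto)
qed (use le in auto)

text \<open>On the circle \<open>Re (h w * cnj (h \<zeta>))\<close> is at most \<open>1\<close>, with equality at \<open>\<zeta>\<close>, so its derivative along the
  circle vanishes there; that derivative is the imaginary part in question.\<close>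

lemma boundary_derivative_real:
  assumes holh: "h holomorphic_on S" and S: "open S" "ball 0 1 \<subseteq> S"
    and le: "\<And>z. norm z < 1 \<Longrightarrow> norm (h z) \<le> 1"
    and \<zeta>: "\<zeta> \<in> S" "norm \<zeta> = 1" "norm (h \<zeta>) = 1"
  shows "Im (\<zeta> * deriv h \<zeta> * cnj (h \<zeta>)) = 0"
proof -
  define F where "F = (\<lambda>\<theta>::real. Re (h (\<zeta> * cis \<theta>) * cnj (h \<zeta>)))"
  have dh: "(h has_field_derivative deriv h \<zeta>) (at \<zeta>)"
    using holomorphic_derivI[OF holh S(1) \<zeta>(1)] .
  have dcis: "((\<lambda>\<theta>. \<zeta> * cis \<theta>) has_vector_derivative \<zeta> * \<i>) (at 0)"
  proof -
    have "((\<lambda>t. \<zeta> * exp (\<i> * t)) has_field_derivative \<zeta> * \<i>) (at (of_real 0))"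
      by (auto intro!: derivative_eq_intros)
    from has_vector_derivative_real_field[OF this] show ?thesis by (simp add: cis_conv_exp)
  qed
  from field_vector_diff_chain_at[OF dcis] dh
  have "((h \<circ> (\<lambda>\<theta>. \<zeta> * cis \<theta>)) has_vector_derivative \<zeta> * \<i> * deriv h \<zeta>) (at 0)"
    by simp
  then have "((\<lambda>\<theta>. h (\<zeta> * cis \<theta>) * cnj (h \<zeta>)) has_vector_derivative \<zeta> * \<i> * deriv h \<zeta> * cnj (h \<zeta>)) (at 0)"
    by (auto simp: o_def intro!: derivative_eq_intros)
  then have "(F has_vector_derivative Re (\<zeta> * \<i> * deriv h \<zeta> * cnj (h \<zeta>))) (at 0)"
    unfolding F_def by (rule bounded_linear.has_vector_derivative[OF bounded_linear_Re])
  then have dF: "DERIV F 0 :> Re (\<zeta> * \<i> * deriv h \<zeta> * cnj (h \<zeta>))"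
    by (simp add: has_real_derivative_iff_has_vector_derivative)
  obtain e where e: "e > 0" "\<And>w. dist w \<zeta> < e \<Longrightarrow> w \<in> S"
    using S(1) \<zeta>(1) unfolding open_dist by blast
  have "((\<lambda>\<theta>. \<zeta> * cis \<theta>) \<longlongrightarrow> \<zeta> * cis 0) (at 0)"
    using has_vector_derivative_continuous[OF dcis] by (simp add: continuous_within)
  from tendstoD[OF this e(1)] obtain d where d: "d > 0" "\<And>\<theta>. \<theta> \<noteq> 0 \<Longrightarrow> dist \<theta> 0 < d \<Longrightarrow> dist (\<zeta> * cis \<theta>) \<zeta> < e"
    unfolding eventually_at by auto
  have "F \<theta> \<le> F 0" if "\<bar>0 - \<theta>\<bar> < d" for \<theta>
  proof -
    have "dist (\<zeta> * cis \<theta>) \<zeta> < e"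
      using d(2)[of \<theta>] that e(1) by (cases "\<theta> = 0") auto
    then have "norm (h (\<zeta> * cis \<theta>)) \<le> 1"
      using disc_bound_extends[OF holomorphic_on_imp_continuous_on[OF holh] S(2) le] e(2) \<zeta>(2)
      by (simp add: norm_mult)
    then have "F \<theta> \<le> 1"
      unfolding F_def using complex_Re_le_cmod[of "h (\<zeta> * cis \<theta>) * cnj (h \<zeta>)"] \<zeta>(3)
      by (simp add: norm_mult)
    moreover have "F 0 = 1"
      unfolding F_def using \<zeta>(3) by (simp flip: complex_norm_square)
    ultimately show ?thesis by simp
  qed
  with DERIV_local_max[OF dF d(1)] have "Re (\<zeta> * \<i> * deriv h \<zeta> * cnj (h \<zeta>)) = 0" by blast
  then show ?thesis by (simp add: algebra_simps)
qed

text \<open>The real part \<open>Re (h (r * \<zeta>) * cnj (h \<zeta>))\<close> and its majorant agree at \<open>r = 1\<close>. Coming from \<open>r < 1\<close>, the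
  smaller function must therefore have the larger derivative at \<open>1\<close>, and the majorant is chosen to
  have derivative \<open>n + \<kappa>\<close>.\<close>

lemma radial_derivative_lower_bound:
  assumes dh: "(h has_field_derivative h') (at \<zeta>)" and \<zeta>: "norm (h \<zeta>) = 1"
    and gap: "\<And>r. 0 < r \<Longrightarrow> r < 1 \<Longrightarrow> norm (h (of_real r * \<zeta>)) \<le> r ^ n * (1 - \<kappa> / 2 * (1 - r\<^sup>2))"
  shows "Re (\<zeta> * h' * cnj (h \<zeta>)) \<ge> real n + \<kappa>"
proof (rule ccontr)
  define F where "F = (\<lambda>r::real. r ^ n * (1 - \<kappa> / 2 * (1 - r\<^sup>2)) - Re (h (of_real r * \<zeta>) * cnj (h \<zeta>)))"
  assume neg: "\<not> ?thesis"
  \<comment> \<open>If the bound failed, the difference \<open>F\<close>, which vanishes at \<open>1\<close>, would be increasing there and negative before.\<close>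
  have "((\<lambda>r. of_real r * \<zeta>) has_vector_derivative \<zeta>) (at 1)"
    by (auto intro!: derivative_eq_intros has_vector_derivative_of_real)
  from field_vector_diff_chain_at[OF this] dh
  have "((h \<circ> (\<lambda>r. of_real r * \<zeta>)) has_vector_derivative \<zeta> * h') (at 1)"
    by simp
  then have "((\<lambda>r. h (of_real r * \<zeta>) * cnj (h \<zeta>)) has_vector_derivative \<zeta> * h' * cnj (h \<zeta>)) (at 1)"
    by (auto simp: o_def intro!: derivative_eq_intros)
  then have "((\<lambda>r. Re (h (of_real r * \<zeta>) * cnj (h \<zeta>))) has_vector_derivative Re (\<zeta> * h' * cnj (h \<zeta>))) (at 1)"
    by (rule bounded_linear.has_vector_derivative[OF bounded_linear_Re])
  then have dRe: "((\<lambda>r. Re (h (of_real r * \<zeta>) * cnj (h \<zeta>))) has_real_derivative Re (\<zeta> * h' * cnj (h \<zeta>))) (at 1)"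
    by (simp add: has_real_derivative_iff_has_vector_derivative)
  have "((\<lambda>r::real. r ^ n * (1 - \<kappa> / 2 * (1 - r\<^sup>2))) has_real_derivative real n + \<kappa>) (at 1)"
    by (auto intro!: derivative_eq_intros)
  from DERIV_diff[OF this dRe]
  have "(F has_real_derivative (real n + \<kappa> - Re (\<zeta> * h' * cnj (h \<zeta>)))) (at 1)"
    unfolding F_def .
  from DERIV_pos_inc_left[OF this] neg obtain d where d: "d > 0" "\<And>e. 0 < e \<Longrightarrow> e < d \<Longrightarrow> F (1 - e) < F 1"
    by auto
  define r where "r = 1 - min (d / 2) (1 / 2)"
  have r: "0 < r" "r < 1" using d(1) by (auto simp: r_def min_def)
  have "F r < F 1" unfolding r_def by (rule d(2)) (use d(1) in auto)
  moreover have "F 1 = 0"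
    unfolding F_def using \<zeta> by (simp flip: complex_norm_square)
  moreover have "Re (h (of_real r * \<zeta>) * cnj (h \<zeta>)) \<le> norm (h (of_real r * \<zeta>))"
    using complex_Re_le_cmod[of "h (of_real r * \<zeta>) * cnj (h \<zeta>)"] \<zeta> by (simp add: norm_mult)
  then have "0 \<le> F r"
    using gap[OF r] unfolding F_def by simp
  ultimately show False by simp
qed

text \<open>Osserman's boundary Schwarz lemma. With \<open>h z = z ^ n * g z\<close>, the power contributes \<open>n\<close> to the radial
  derivative and \<open>disc_map_boundary_gap\<close> bounds the contribution of \<open>g\<close> from below. This contribution
  is positive as soon as \<open>g\<close> takes values in the open disc, which leaves constant \<open>g\<close> as the only
  extremal case.\<close>

lemma boundary_schwarz_osserman:
  assumes holh: "h holomorphic_on S" and S: "open S" "ball 0 1 \<subseteq> S"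
    and le: "\<And>z. norm z < 1 \<Longrightarrow> norm (h z) \<le> 1"
    and \<zeta>: "\<zeta> \<in> S" "norm \<zeta> = 1" "norm (h \<zeta>) = 1"
    and van: "\<And>k. k < n \<Longrightarrow> (deriv ^^ k) h 0 = 0"
  defines "s \<equiv> norm ((deriv ^^ n) h 0) / fact n" and "t \<equiv> norm ((deriv ^^ Suc n) h 0) / fact (Suc n)"
    and "lam \<equiv> Re (\<zeta> * deriv h \<zeta> * cnj (h \<zeta>))"
  shows "lam \<ge> real n"
    and "s < 1 \<Longrightarrow> lam \<ge> real n + 2 * (1 - s)\<^sup>2 / (1 - s\<^sup>2 + t)"
    and "lam = real n \<Longrightarrow> \<exists>c. norm c = 1 \<and> (\<forall>z. norm z < 1 \<longrightarrow> h z = z ^ n * c)"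
proof -
  have holB: "h holomorphic_on ball 0 1" using holh S(2) by (rule holomorphic_on_subset)
  obtain g where g: "g holomorphic_on ball 0 1" "\<And>z. norm z < 1 \<Longrightarrow> norm (g z) \<le> 1"
    "\<And>z. norm z < 1 \<Longrightarrow> h z = z ^ n * g z"
    "\<And>k. (deriv ^^ k) g 0 / fact k = (deriv ^^ (n + k)) h 0 / fact (n + k)"
    using disc_map_factor_power[OF holB le van] by metis
  have "norm ((deriv ^^ k) g 0) / fact k = norm ((deriv ^^ (n + k)) h 0) / fact (n + k)" for k
    using arg_cong[OF g(4)[of k], of norm] by (simp add: norm_divide)
  from this[of 0] this[of 1] have st: "s = norm (g 0)" "t = norm (deriv g 0)"
    by (simp_all add: s_def t_def)
  have dh: "(h has_field_derivative deriv h \<zeta>) (at \<zeta>)"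
    using holomorphic_derivI[OF holh S(1) \<zeta>(1)] .
  have norm_h: "norm (h (of_real r * \<zeta>)) = r ^ n * norm (g (of_real r * \<zeta>))" if "0 < r" "r < 1" for r
    using g(3)[of "of_real r * \<zeta>"] that \<zeta>(2) by (simp add: norm_mult norm_power)
  show 1: "lam \<ge> real n"
    unfolding lam_def using radial_derivative_lower_bound[OF dh \<zeta>(3), of n 0] g(2) \<zeta>(2)
    by (simp add: norm_h mult_left_le norm_mult)
  have pos: "1 - s\<^sup>2 + t > 0" if "s < 1"
  proof -
    have "s\<^sup>2 < 1" using that by (simp add: st(1) abs_square_less_1)
    moreover have "0 \<le> t" by (simp add: st(2))
    ultimately show ?thesis by linarith
  qed
  show 2: "lam \<ge> real n + 2 * (1 - s)\<^sup>2 / (1 - s\<^sup>2 + t)" if s: "s < 1"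
  unfolding lam_def
  proof (rule radial_derivative_lower_bound[OF dh \<zeta>(3)])
    fix r :: real assume r: "0 < r" "r < 1"
    have lt: "norm (g z) < 1" if "norm z < 1" for z
      using disc_map_less_or_const[OF g(1,2)] s st(1) that
      by (metis less_irrefl norm_zero zero_less_one)
    have "(1 - s)\<^sup>2 * (1 - r\<^sup>2) \<le> (1 - norm (g (of_real r * \<zeta>))) * (1 - s\<^sup>2 + t)"
      using disc_map_boundary_gap[OF g(1) lt, of "of_real r * \<zeta>"] r \<zeta>(2) by (simp add: st norm_mult)
    with pos[OF s] have "(1 - s)\<^sup>2 * (1 - r\<^sup>2) / (1 - s\<^sup>2 + t) \<le> 1 - norm (g (of_real r * \<zeta>))"
      by (simp add: pos_divide_le_eq)
    moreover have "2 * A / D / 2 * B = A * B / D" for A B D :: real by simp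
    ultimately have "norm (g (of_real r * \<zeta>)) \<le> 1 - 2 * (1 - s)\<^sup>2 / (1 - s\<^sup>2 + t) / 2 * (1 - r\<^sup>2)"
      by (metis le_diff_eq add.commute)
    then show "norm (h (of_real r * \<zeta>)) \<le> r ^ n * (1 - 2 * (1 - s)\<^sup>2 / (1 - s\<^sup>2 + t) / 2 * (1 - r\<^sup>2))"
      unfolding norm_h[OF r] using r by (intro mult_left_mono) auto
  qed
  show "\<exists>c. norm c = 1 \<and> (\<forall>z. norm z < 1 \<longrightarrow> h z = z ^ n * c)" if eq: "lam = real n"
  proof (rule disc_map_less_or_const[OF g(1,2)])
    assume lt: "\<And>z. norm z < 1 \<Longrightarrow> norm (g z) < 1"
    have s: "s < 1" using lt[of 0] st by simp
    then have "2 * (1 - s)\<^sup>2 / (1 - s\<^sup>2 + t) > 0" using pos[OF s] by simp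
    then show ?thesis using 2[OF s] eq by linarith
  next
    fix c assume "norm c = 1" "\<And>z. norm z < 1 \<Longrightarrow> g z = c"
    then show ?thesis using g(3) by (intro exI[of _ c]) simp
  qed
qed

lemma derivative_quotient_le_one:
  assumes "h holomorphic_on ball 0 1" "\<And>z. norm z < 1 \<Longrightarrow> norm (h z) \<le> 1"
    and "\<And>k. k < n \<Longrightarrow> (deriv ^^ k) h 0 = 0"
  shows "norm ((deriv ^^ n) h 0) / fact n \<le> 1" and "norm z < 1 \<Longrightarrow> norm (h z) \<le> norm z ^ n"
proof -
  obtain g where g: "\<And>z. norm z < 1 \<Longrightarrow> norm (g z) \<le> 1"
    "\<And>z. norm z < 1 \<Longrightarrow> h z = z ^ n * g z"
    "\<And>k. (deriv ^^ k) g 0 / fact k = (deriv ^^ (n + k)) h 0 / fact (n + k)"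
    using disc_map_factor_power[OF assms] by metis
  show "norm ((deriv ^^ n) h 0) / fact n \<le> 1"
    using arg_cong[OF g(3)[of 0], of norm] g(1)[of 0] by (simp add: norm_divide)
  show "norm (h z) \<le> norm z ^ n" if "norm z < 1"
    using g(1)[OF that] g(2)[OF that] by (simp add: norm_mult norm_power mult_left_le)
qed

text \<open>Passing to a coordinate of a quaternion-valued map can only decrease Taylor coefficients; by this
  monotonicity the bound obtained for the coordinate implies the one for the map itself.\<close>

lemma osserman_bound_antimono:
  fixes s s' t t' :: real
  assumes "0 \<le> s" "s \<le> s'" "s' < 1" "0 \<le> t" "t \<le> t'"
  shows "2 * (1 - s')\<^sup>2 / (1 - s'\<^sup>2 + t') \<le> 2 * (1 - s)\<^sup>2 / (1 - s\<^sup>2 + t)"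
proof -
  have "s\<^sup>2 < 1" "s'\<^sup>2 < 1" using assms by (simp_all add: abs_square_less_1)
  then have pos: "1 - s\<^sup>2 + t > 0" "1 - s'\<^sup>2 + t' > 0" using assms by linarith+
  have "(1 - s') * (1 - s) * ((1 - s') * (1 + s)) \<le> (1 - s') * (1 - s) * ((1 - s) * (1 + s'))"
    using assms by (intro mult_left_mono mult_nonneg_nonneg) (auto simp: algebra_simps)
  moreover have "(1 - s')\<^sup>2 * t \<le> (1 - s)\<^sup>2 * t'"
    using assms by (intro mult_mono power_mono) auto
  ultimately have "(1 - s')\<^sup>2 * (1 - s\<^sup>2 + t) \<le> (1 - s)\<^sup>2 * (1 - s'\<^sup>2 + t')"
    by (simp add: power2_eq_square algebra_simps)
  then show ?thesis using pos by (simp add: frac_le_eq divide_le_eq field_simps)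
qed

section \<open>Slices and their complex coordinates\<close>

lemma qcnj_sel [simp]:
  "qRe (qcnj q) = qRe q" "qIm1 (qcnj q) = - qIm1 q" "qIm2 (qcnj q) = - qIm2 q" "qIm3 (qcnj q) = - qIm3 q"
  by (simp_all add: qcnj_def)

lemma qcnj_mult: "qcnj (p * q) = qcnj q * qcnj p"
  by (simp add: quat_eq_iff algebra_simps)

lemma qcnj_diff: "qcnj (p - q) = qcnj p - qcnj q"
  by (simp add: quat_eq_iff)

lemma qcnj_scaleR: "qcnj (r *\<^sub>R q) = r *\<^sub>R qcnj q"
  by (simp add: quat_eq_iff)

lemma qcnj_qcnj [simp]: "qcnj (qcnj q) = q"
  by (simp add: quat_eq_iff)

lemma norm_quat_square: "(norm q)\<^sup>2 = (qRe q)\<^sup>2 + (qIm1 q)\<^sup>2 + (qIm2 q)\<^sup>2 + (qIm3 q)\<^sup>2"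
  by (simp add: norm_quat_def)

lemma inner_quat_eq_qRe: "inner p q = qRe (p * qcnj q)"
  by (simp add: inner_quat_def)

lemma inner_mult_left_adjoint: "inner (p * q) r = inner q (qcnj p * r)"
  by (simp add: inner_quat_def algebra_simps)

lemma qcnj_imag_unit: "I \<in> imag_units \<Longrightarrow> qcnj I = - I"
  by (simp add: imag_units_iff quat_eq_iff)

lemma norm_imag_unit: "I \<in> imag_units \<Longrightarrow> norm I = 1"
  by (simp add: imag_units_iff norm_quat_def)

lemma uminus_imag_unit: "I \<in> imag_units \<Longrightarrow> - I \<in> imag_units"
  by (simp add: imag_units_iff)

lemma imag_unit_mult_twice: "I \<in> imag_units \<Longrightarrow> I * (I * q) = - q"
  by (metis imag_unit_square mult.assoc mult_minus1)

text \<open>The embedding of the complex plane as the slice \<open>\<real> + \<real> I\<close>; for an imaginary unit \<open>I\<close> it is a homomorphism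
  of algebras, which lets complex arithmetic replace computations inside a slice.\<close>

definition slice_emb :: "quat \<Rightarrow> complex \<Rightarrow> quat" where
  "slice_emb I z = slice_pt I (Re z) (Im z)"

lemma slice_emb_alt: "slice_emb I z = of_real (Re z) + Im z *\<^sub>R I"
  by (simp add: slice_emb_def slice_pt_def scaleR_conv_of_real)

lemma slice_emb_Complex: "slice_emb I (Complex x y) = slice_pt I x y"
  by (simp add: slice_emb_def)

lemma slice_emb_of_real [simp]: "slice_emb I (of_real x) = of_real x"
  by (simp add: slice_emb_alt)

lemma slice_emb_0 [simp]: "slice_emb I 0 = 0"
  by (simp add: slice_emb_alt)

lemma slice_emb_1 [simp]: "slice_emb I 1 = 1"
  by (simp add: slice_emb_alt)

lemma slice_emb_i [simp]: "slice_emb I \<i> = I"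
  by (simp add: slice_emb_alt)

lemma slice_emb_diff: "slice_emb I (z - w) = slice_emb I z - slice_emb I w"
  by (simp add: slice_emb_alt scaleR_left_diff_distrib)

lemma slice_emb_mult:
  assumes "I \<in> imag_units"
  shows "slice_emb I (z * w) = slice_emb I z * slice_emb I w"
proof -
  have "I * I = - 1" using imag_unit_square[OF assms] .
  then show ?thesis
    unfolding slice_emb_alt
    by (simp add: of_real_def scaleR_left_diff_distrib distrib_left distrib_right scaleR_left_distrib algebra_simps)
qed

lemma slice_emb_commute:
  assumes "I \<in> imag_units"
  shows "slice_emb I z * slice_emb I w = slice_emb I w * slice_emb I z"
  by (metis slice_emb_mult[OF assms] mult.commute)

lemma slice_emb_power:
  assumes "I \<in> imag_units"
  shows "slice_emb I (z ^ n) = slice_emb I z ^ n"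
  by (induction n) (simp_all add: slice_emb_mult[OF assms])

lemma slice_emb_cnj: "slice_emb I (cnj z) = slice_emb (- I) z"
  by (simp add: slice_emb_alt)

lemma qcnj_slice_emb:
  assumes "I \<in> imag_units"
  shows "qcnj (slice_emb I z) = slice_emb I (cnj z)"
  using assms by (simp add: slice_emb_alt quat_eq_iff imag_units_iff)

lemma norm_slice_emb:
  assumes "I \<in> imag_units"
  shows "norm (slice_emb I z) = norm z"
proof -
  have "(Im z * qIm1 I)\<^sup>2 + (Im z * qIm2 I)\<^sup>2 + (Im z * qIm3 I)\<^sup>2
      = (Im z)\<^sup>2 * ((qIm1 I)\<^sup>2 + (qIm2 I)\<^sup>2 + (qIm3 I)\<^sup>2)"
    by (simp add: power_mult_distrib algebra_simps)
  then show ?thesis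
    using assms by (simp add: slice_emb_alt imag_units_iff norm_quat_def cmod_def)
qed

lemma bounded_linear_slice_emb: "bounded_linear (slice_emb I)"
proof -
  have "bounded_linear (\<lambda>z. Re z *\<^sub>R 1 + Im z *\<^sub>R I)"
    by (intro bounded_linear_add bounded_linear_compose[OF bounded_linear_scaleR_left]
        bounded_linear_Re bounded_linear_Im)
  then show ?thesis by (simp add: slice_emb_alt[abs_def] of_real_def)
qed

lemma continuous_slice_emb: "continuous_on S (slice_emb I)"
  by (rule linear_continuous_on[OF bounded_linear_slice_emb])

lemma open_vimage_slice_emb: "open \<Omega> \<Longrightarrow> open (slice_emb I -` \<Omega>)"
  by (rule open_vimage[OF _ continuous_slice_emb])

lemma quat_slice_emb:
  obtains I z where "I \<in> imag_units" "q = slice_emb I z"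
  using quat_slice_form[of q] by (metis slice_emb_Complex)

text \<open>Left multiplication by the slice \<open>\<real> + \<real> I\<close> makes the quaternions a complex vector space of dimension two,
  and this is the Hermitian product with \<open>w\<close>. Using all these functionals at once avoids the choice of a
  second imaginary unit orthogonal to \<open>I\<close> that a splitting into two complex coordinates would require.\<close>

definition slice_coord :: "quat \<Rightarrow> quat \<Rightarrow> quat \<Rightarrow> complex" where
  "slice_coord I w v = Complex (inner v w) (inner v (I * w))"

lemma Re_slice_coord [simp]: "Re (slice_coord I w v) = inner v w"
  by (simp add: slice_coord_def)

lemma slice_coord_eqI:
  assumes "\<And>w. slice_coord I w u = slice_coord I w v"
  shows "u = v"
proof (rule vector_eq_rdot[THEN iffD1], rule allI)
  fix w
  show "inner u w = inner v w"
    using assms[of w] by (metis Re_slice_coord)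
qed

lemma slice_coord_slice_emb_mult:
  assumes I: "I \<in> imag_units"
  shows "slice_coord I w (slice_emb I z * v) = z * slice_coord I w v"
proof -
  have 1: "inner (I * v) r = - inner v (I * r)" for r
    by (simp add: inner_mult_left_adjoint qcnj_imag_unit[OF I] inner_minus_right)
  show ?thesis
    by (simp add: imag_unit_mult_twice[OF I] complex_eq_iff slice_coord_def slice_emb_alt distrib_right inner_add_left 1 of_real_def)
qed

lemma bounded_linear_slice_coord: "bounded_linear (slice_coord I w)"
proof -
  have "bounded_linear (\<lambda>v. of_real (inner v w) + \<i> * of_real (inner v (I * w)))"
    by (intro bounded_linear_add bounded_linear_compose[OF bounded_linear_mult_right]
      bounded_linear_compose[OF bounded_linear_of_real] bounded_linear_inner_left)
  then show ?thesis
    by (simp add: slice_coord_def[abs_def] Complex_eq)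
qed

lemma slice_coord_diff: "slice_coord I w (u - v) = slice_coord I w u - slice_coord I w v"
  by (rule bounded_linear.axioms(1)[OF bounded_linear_slice_coord, THEN linear_diff])

lemma slice_coord_add: "slice_coord I w (u + v) = slice_coord I w u + slice_coord I w v"
  by (rule bounded_linear.axioms(1)[OF bounded_linear_slice_coord, THEN linear_add])

lemma slice_coord_0 [simp]: "slice_coord I w 0 = 0"
  by (simp add: slice_coord_def complex_eq_iff)

lemma slice_coord_scaleR: "slice_coord I w (r *\<^sub>R u) = of_real r * slice_coord I w u"
  by (simp add: slice_coord_def complex_eq_iff)

lemma slice_coord_self:
  assumes I: "I \<in> imag_units"
  shows "slice_coord I w w = of_real ((norm w)\<^sup>2)"
proof -
  have "inner w (I * w) = - inner w (I * w)"
    by (metis inner_commute inner_minus_right inner_mult_left_adjoint mult_minus_left qcnj_imag_unit[OF I])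
  then show ?thesis
    by (simp add: slice_coord_def complex_eq_iff power2_norm_eq_inner)
qed

lemma norm_slice_coord_le:
  assumes I: "I \<in> imag_units"
  shows "norm (slice_coord I w v) \<le> norm v * norm w"
proof (cases "slice_coord I w v = 0")
  case False
  \<comment> \<open>A rotation within the slice makes the coordinate real, and its real part is a scalar product.\<close>
  define c where "c = cnj (slice_coord I w v) / norm (slice_coord I w v)"
  have c: "norm c = 1" using False by (simp add: c_def norm_divide)
  have "c * slice_coord I w v = norm (slice_coord I w v)"
    using False by (simp add: c_def mult.commute complex_norm_square[symmetric] power2_eq_square)
  then have "norm (slice_coord I w v) = Re (slice_coord I w (slice_emb I c * v))"
    unfolding slice_coord_slice_emb_mult[OF I] by simp
  also have "\<dots> \<le> norm (slice_emb I c * v) * norm w"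
    unfolding Re_slice_coord by (rule norm_cauchy_schwarz)
  finally show ?thesis by (simp add: norm_mult norm_slice_emb[OF I] c)
qed simp

text \<open>The case of equality in the Cauchy-Schwarz inequality.\<close>

lemma slice_coord_extremal:
  assumes I: "I \<in> imag_units" and w: "norm w = 1" and c: "slice_coord I w v = c" and v: "norm v \<le> norm c"
  shows "v = slice_emb I c * w"
proof -
  have "inner v (slice_emb I c * w) = Re (slice_coord I w (slice_emb I (cnj c) * v))"
    by (metis I Re_slice_coord inner_commute inner_mult_left_adjoint qcnj_slice_emb)
  also have "\<dots> = (norm c)\<^sup>2"
    unfolding slice_coord_slice_emb_mult[OF I] c by (metis Re_complex_of_real complex_norm_square mult.commute)
  finally have "(norm (v - slice_emb I c * w))\<^sup>2 = (norm v)\<^sup>2 + (norm c)\<^sup>2 - 2 * (norm c)\<^sup>2"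
    unfolding power2_norm_eq_inner[of "v - slice_emb I c * w"] inner_diff_left inner_diff_right
    by (simp add: inner_commute power2_norm_eq_inner[symmetric] norm_mult norm_slice_emb[OF I] w)
  also have "\<dots> \<le> 0"
    using power_mono[OF v norm_ge_zero, of 2] by simp
  finally show ?thesis by simp
qed

section \<open>Slice regularity as holomorphy of the coordinates\<close>

text \<open>The coordinates determine the map, so if all of them are holomorphic, then the map itself is
  differentiable, and its derivative is linear over the slice: it is multiplication, from the right, by
  a quaternion.\<close>

lemma slice_hol_has_derivative:
  assumes I: "I \<in> imag_units" and U: "open U" "z \<in> U"
    and hol: "\<And>w. (\<lambda>z. slice_coord I w (u z)) holomorphic_on U"
  obtains d where "(u has_derivative (\<lambda>t. slice_emb I t * d)) (at z)"
    "\<And>w. deriv (\<lambda>z. slice_coord I w (u z)) z = slice_coord I w d"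
proof -
  have dw: "((\<lambda>z. slice_coord I w (u z)) has_field_derivative deriv (\<lambda>z. slice_coord I w (u z)) z) (at z)" for w
    by (rule holomorphic_derivI[OF hol U])
  have "(\<lambda>z. inner (u z) w) differentiable at z" for w
  proof -
    have "((\<lambda>z. Re (slice_coord I w (u z))) has_derivative
        (\<lambda>t. Re (deriv (\<lambda>z. slice_coord I w (u z)) z * t))) (at z)"
      using bounded_linear.has_derivative[OF bounded_linear_Re dw[of w, unfolded has_field_derivative_def]] .
    then show ?thesis by (auto simp: differentiable_def)
  qed
  then have "u differentiable at z"
    using differentiable_componentwise_within[of u z UNIV] by blast
  then obtain D where D: "(u has_derivative D) (at z)"
    by (auto simp: differentiable_def)
  have LD: "slice_coord I w (D t) = deriv (\<lambda>z. slice_coord I w (u z)) z * t" for w t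
    using has_derivative_unique[OF bounded_linear.has_derivative[OF bounded_linear_slice_coord D]
        dw[of w, unfolded has_field_derivative_def]] by (rule fun_cong)
  have "D t = slice_emb I t * D 1" for t
    by (rule slice_coord_eqI[of I]) (simp add: slice_coord_slice_emb_mult[OF I] LD)
  then have "D = (\<lambda>t. slice_emb I t * D 1)" by (rule ext)
  then show ?thesis
    using that[of "D 1"] D LD[of _ 1] by simp
qed

lemma slice_partials_of_derivative:
  assumes d: "((\<lambda>z. f (slice_emb I z)) has_derivative (\<lambda>t. slice_emb I t * d)) (at (Complex x y))"
  shows "((\<lambda>t. f (slice_pt I t y)) has_vector_derivative d) (at x)"
    and "((\<lambda>t. f (slice_pt I x t)) has_vector_derivative I * d) (at y)"
proof -
  have 1: "((\<lambda>t. Complex t y) has_derivative (\<lambda>t. of_real t)) (at x)"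
    unfolding Complex_eq by (auto intro!: derivative_eq_intros)
  have "((\<lambda>t. f (slice_emb I (Complex t y))) has_derivative (\<lambda>t. slice_emb I (of_real t) * d)) (at x)"
    using has_derivative_compose[OF 1 d] .
  then show "((\<lambda>t. f (slice_pt I t y)) has_vector_derivative d) (at x)"
    by (simp add: has_vector_derivative_def slice_emb_Complex scaleR_conv_of_real)
  have 2: "((\<lambda>t. Complex x t) has_derivative (\<lambda>t. \<i> * of_real t)) (at y)"
    unfolding Complex_eq by (auto intro!: derivative_eq_intros)
  have "((\<lambda>t. f (slice_emb I (Complex x t))) has_derivative (\<lambda>t. slice_emb I (\<i> * of_real t) * d)) (at y)"
    using has_derivative_compose[OF 2 d] .
  moreover have "slice_emb I (\<i> * of_real t) * d = t *\<^sub>R (I * d)" for t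
    by (simp add: slice_emb_alt)
  ultimately show "((\<lambda>t. f (slice_pt I x t)) has_vector_derivative I * d) (at y)"
    by (simp add: has_vector_derivative_def slice_emb_Complex)
qed

text \<open>Continuity of the partial derivatives gives total differentiability on the slice, and the
  Cauchy-Riemann equation says that the total derivative is linear over the slice; coordinates turn
  this into complex differentiability.\<close>

lemma slice_regular_imp_holomorphic:
  assumes \<Omega>: "open \<Omega>" and f: "slice_regular_on f \<Omega>" and I: "I \<in> imag_units"
  shows "(\<lambda>z. slice_coord I w (f (slice_emb I z))) holomorphic_on (slice_emb I -` \<Omega>)"
  unfolding holomorphic_on_open[OF open_vimage_slice_emb[OF \<Omega>]]
proof
  fix z assume z: "z \<in> slice_emb I -` \<Omega>"
  define U where "U = {(x, y). slice_pt I x y \<in> \<Omega>}"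
  define x y where "x = Re z" and "y = Im z"
  have "U = (\<lambda>p. slice_emb I (of_real (fst p) + \<i> * of_real (snd p))) -` \<Omega>"
    by (auto simp: U_def slice_emb_def)
  moreover have "continuous_on UNIV (\<lambda>p :: real \<times> real. slice_emb I (of_real (fst p) + \<i> * of_real (snd p)))"
    by (intro continuous_on_compose2[OF continuous_slice_emb[of UNIV]] continuous_intros) auto
  ultimately have "open U" using open_vimage[OF \<Omega>] by simp
  have xy: "(x, y) \<in> U" using z by (simp add: U_def x_def y_def slice_emb_def)
  \<comment> \<open>A product neighbourhood with a convex second factor, so that the partial derivatives determine the total one.\<close>
  obtain A B where AB: "open A" "open B" "(x, y) \<in> A \<times> B" "A \<times> B \<subseteq> U"
    using open_prod_elim[OF \<open>open U\<close> xy] by blast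
  obtain e where e: "e > 0" "ball y e \<subseteq> B" using AB(2,3) by (auto elim: openE)
  have sub: "A \<times> ball y e \<subseteq> U" using AB(4) e(2) by blast
  have fI: "\<And>x y. (x, y) \<in> U \<Longrightarrow> (\<lambda>t. f (slice_pt I t y)) differentiable (at x)"
    "\<And>x y. (x, y) \<in> U \<Longrightarrow> (\<lambda>t. f (slice_pt I x t)) differentiable (at y)"
    "continuous_on U (\<lambda>(x, y). slice_dy f I x y)"
    "\<And>x y. (x, y) \<in> U \<Longrightarrow> (1/2) *\<^sub>R (slice_dx f I x y + I * slice_dy f I x y) = 0"
    using bspec[OF f[unfolded slice_regular_on_def] I] by (auto simp: U_def)
  have dx: "((\<lambda>t. f (slice_pt I t y)) has_vector_derivative slice_dx f I x y) (at x)" if "(x, y) \<in> U" for x y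
    using fI(1)[OF that] unfolding slice_dx_def by (rule vector_derivative_works[THEN iffD1])
  have dy: "((\<lambda>t. f (slice_pt I x t)) has_vector_derivative slice_dy f I x y) (at y)" if "(x, y) \<in> U" for x y
    using fI(2)[OF that] unfolding slice_dy_def by (rule vector_derivative_works[THEN iffD1])
  have op: "open (A \<times> ball y e)" using AB(1) by (intro open_Times) auto
  have xyin: "(x, y) \<in> A \<times> ball y e" using AB(3) e(1) by auto
  have "((\<lambda>(x, y). f (slice_pt I x y)) has_derivative
      (\<lambda>(tx, ty). tx *\<^sub>R slice_dx f I x y + blinfun_scaleR_left (slice_dy f I x y) ty)) (at (x, y) within A \<times> ball y e)"
  proof (rule has_derivative_partialsI)
    show "((\<lambda>t. f (slice_pt I t y)) has_derivative (\<lambda>tx. tx *\<^sub>R slice_dx f I x y)) (at x within A)"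
      using dx[OF xy] unfolding has_vector_derivative_def by (rule has_derivative_at_withinI)
    show "((\<lambda>t. f (slice_pt I x' t)) has_derivative blinfun_apply (blinfun_scaleR_left (slice_dy f I x' y'))) (at y' within ball y e)"
      if "x' \<in> A" "y' \<in> ball y e" for x' y'
    proof -
      have "(x', y') \<in> U" using that sub by blast
      from dy[OF this] show ?thesis
        unfolding has_vector_derivative_def blinfun_scaleR_left.rep_eq by (rule has_derivative_at_withinI)
    qed
    have "continuous_on (A \<times> ball y e) (\<lambda>p. blinfun_scaleR_left ((\<lambda>(x, y). slice_dy f I x y) p))"
      by (rule bounded_linear.continuous_on[OF bounded_linear_blinfun_scaleR_left continuous_on_subset[OF fI(3) sub]])
    then show "continuous (at (x, y) within A \<times> ball y e) (\<lambda>(x, y). blinfun_scaleR_left (slice_dy f I x y))"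
      using xyin unfolding continuous_on_eq_continuous_within case_prod_beta' by blast
  qed (use e(1) in auto)
  then have partials: "((\<lambda>(x, y). f (slice_pt I x y)) has_derivative
      (\<lambda>(tx, ty). tx *\<^sub>R slice_dx f I x y + ty *\<^sub>R slice_dy f I x y)) (at (Re z, Im z))"
    using at_within_open[OF xyin op] by (simp add: blinfun_scaleR_left.rep_eq x_def y_def)
  have "((\<lambda>z. (Re z, Im z)) has_derivative (\<lambda>t. (Re t, Im t))) (at z)"
    by (intro has_derivative_Pair bounded_linear_imp_has_derivative bounded_linear_Re bounded_linear_Im)
  from has_derivative_compose[OF this partials]
  have D: "((\<lambda>z. f (slice_emb I z)) has_derivative
      (\<lambda>t. Re t *\<^sub>R slice_dx f I x y + Im t *\<^sub>R slice_dy f I x y)) (at z)"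
    by (simp add: slice_emb_def)
  have "slice_dy f I x y = I * slice_dx f I x y"
  proof -
    have 0: "slice_dx f I x y + I * slice_dy f I x y = 0"
      using fI(4)[OF xy] by simp
    have "I * (slice_dx f I x y + I * slice_dy f I x y) = I * slice_dx f I x y + (I * I) * slice_dy f I x y"
      by (simp add: distrib_left mult.assoc)
    then show ?thesis unfolding 0 imag_unit_square[OF I] by simp
  qed
  then have "Re t *\<^sub>R slice_dx f I x y + Im t *\<^sub>R slice_dy f I x y = slice_emb I t * slice_dx f I x y" for t
    by (simp add: slice_emb_alt distrib_right of_real_def)
  with D have "((\<lambda>z. f (slice_emb I z)) has_derivative (\<lambda>t. slice_emb I t * slice_dx f I x y)) (at z)"
    by simp
  from bounded_linear.has_derivative[OF bounded_linear_slice_coord[of I w] this]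
  have "((\<lambda>z. slice_coord I w (f (slice_emb I z))) has_field_derivative slice_coord I w (slice_dx f I x y)) (at z)"
    unfolding has_field_derivative_def slice_coord_slice_emb_mult[OF I] by (simp add: mult.commute[of _ "slice_coord I w (slice_dx f I x y)"])
  then show "\<exists>d. ((\<lambda>z. slice_coord I w (f (slice_emb I z))) has_field_derivative d) (at z)" ..
qed

text \<open>The bridge to complex analysis. Conversely, holomorphic functions have continuous derivatives,
  and these control the partial derivatives of \<open>f\<close> coordinate by coordinate.\<close>

lemma slice_regular_iff_holomorphic:
  assumes \<Omega>: "open \<Omega>"
  shows "slice_regular_on f \<Omega> \<longleftrightarrow>
    (\<forall>I\<in>imag_units. \<forall>w. (\<lambda>z. slice_coord I w (f (slice_emb I z))) holomorphic_on (slice_emb I -` \<Omega>))"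
proof (intro iffI ballI allI)
  assume hol: "\<forall>I\<in>imag_units. \<forall>w. (\<lambda>z. slice_coord I w (f (slice_emb I z))) holomorphic_on (slice_emb I -` \<Omega>)"
  show "slice_regular_on f \<Omega>"
    unfolding slice_regular_on_def
  proof (intro ballI)
    fix I assume I: "I \<in> imag_units"
    let ?U = "slice_emb I -` \<Omega>"
    let ?S = "{(x, y). slice_pt I x y \<in> \<Omega>}"
    have holI: "\<And>w. (\<lambda>z. slice_coord I w (f (slice_emb I z))) holomorphic_on ?U"
      using hol I by blast
    have ex: "\<exists>d. ((\<lambda>t. f (slice_pt I t y)) has_vector_derivative d) (at x) \<and>
        ((\<lambda>t. f (slice_pt I x t)) has_vector_derivative I * d) (at y) \<and>
        (\<forall>w. slice_coord I w d = deriv (\<lambda>z. slice_coord I w (f (slice_emb I z))) (Complex x y))"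
      if "slice_pt I x y \<in> \<Omega>" for x y
    proof -
      have "Complex x y \<in> ?U" using that by (simp add: slice_emb_Complex)
      from slice_hol_has_derivative[OF I open_vimage_slice_emb[OF \<Omega>] this holI]
      obtain d where "((\<lambda>z. f (slice_emb I z)) has_derivative (\<lambda>t. slice_emb I t * d)) (at (Complex x y))"
        "\<And>w. deriv (\<lambda>z. slice_coord I w (f (slice_emb I z))) (Complex x y) = slice_coord I w d"
        by metis
      then show ?thesis using slice_partials_of_derivative[of f I d x y] by metis
    qed
    have dxy: "((\<lambda>t. f (slice_pt I t y)) has_vector_derivative slice_dx f I x y) (at x)"
        "((\<lambda>t. f (slice_pt I x t)) has_vector_derivative slice_dy f I x y) (at y)"
        "slice_dy f I x y = I * slice_dx f I x y"
        "slice_coord I w (slice_dx f I x y) = deriv (\<lambda>z. slice_coord I w (f (slice_emb I z))) (Complex x y)"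
      if "slice_pt I x y \<in> \<Omega>" for x y w
      using ex[OF that] unfolding slice_dx_def slice_dy_def
      by (metis vector_derivative_at)+
    have cont: "continuous_on ?S (\<lambda>(x, y). slice_dx f I x y)"
    proof (subst continuous_on_componentwise, rule ballI)
      fix b :: quat
      have "continuous_on ?S (\<lambda>p. Re (deriv (\<lambda>z. slice_coord I b (f (slice_emb I z))) (of_real (fst p) + \<i> * of_real (snd p))))"
        by (intro continuous_intros continuous_on_compose2[OF holomorphic_on_imp_continuous_on[OF holomorphic_deriv[OF holI open_vimage_slice_emb[OF \<Omega>]]]])
          (auto simp: slice_emb_def)
      then show "continuous_on ?S (\<lambda>p. inner (case p of (x, y) \<Rightarrow> slice_dx f I x y) b)"
      proof (rule continuous_on_eq)
        fix p assume "p \<in> ?S"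
        then obtain x y where p: "p = (x, y)" "slice_pt I x y \<in> \<Omega>" by auto
        show "Re (deriv (\<lambda>z. slice_coord I b (f (slice_emb I z))) (of_real (fst p) + \<i> * of_real (snd p)))
            = inner (case p of (x, y) \<Rightarrow> slice_dx f I x y) b"
          using arg_cong[OF dxy(4)[OF p(2), of b], of Re] by (simp add: p(1) Complex_eq)
      qed
    qed
    have "continuous_on ?S (\<lambda>p. I * (case p of (x, y) \<Rightarrow> slice_dx f I x y))"
      using cont by (intro continuous_intros)
    then have "continuous_on ?S (\<lambda>(x, y). slice_dy f I x y)"
      by (rule continuous_on_eq) (auto simp: dxy(3))
    moreover have "slice_dx f I x y + I * slice_dy f I x y = 0" if "slice_pt I x y \<in> \<Omega>" for x y
      unfolding dxy(3)[OF that] by (simp add: mult.assoc[symmetric] imag_unit_square[OF I])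
    ultimately show "(\<forall>x y. slice_pt I x y \<in> \<Omega> \<longrightarrow>
           (\<lambda>t. f (slice_pt I t y)) differentiable (at x) \<and>
           (\<lambda>t. f (slice_pt I x t)) differentiable (at y)) \<and>
        continuous_on {(x, y). slice_pt I x y \<in> \<Omega>} (\<lambda>(x, y). slice_dx f I x y) \<and>
        continuous_on {(x, y). slice_pt I x y \<in> \<Omega>} (\<lambda>(x, y). slice_dy f I x y) \<and>
        (\<forall>x y. slice_pt I x y \<in> \<Omega> \<longrightarrow>
           (1/2) *\<^sub>R (slice_dx f I x y + I * slice_dy f I x y) = 0)"
      using cont differentiableI_vector[OF dxy(1)] differentiableI_vector[OF dxy(2)] by auto
  qed
qed (use slice_regular_imp_holomorphic[OF \<Omega>] in blast)

lemma slice_regular_cong: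
  assumes \<Omega>: "open \<Omega>" and f: "slice_regular_on f \<Omega>" and eq: "\<And>q. q \<in> \<Omega> \<Longrightarrow> f q = g q"
  shows "slice_regular_on g \<Omega>"
  unfolding slice_regular_iff_holomorphic[OF \<Omega>]
proof (intro ballI allI)
  fix I w assume "I \<in> imag_units"
  from slice_regular_imp_holomorphic[OF \<Omega> f this, of w]
  show "(\<lambda>z. slice_coord I w (g (slice_emb I z))) holomorphic_on slice_emb I -` \<Omega>"
    by (rule holomorphic_transform) (simp add: eq)
qed

text \<open>The point \<open>slice_emb I z\<close> may have several representations \<open>slice_pt J x y\<close>, but they all describe the same
  line parallel to the real axis, and the slice derivative is the derivative along that line.\<close>

lemma slice_deriv_works:
  assumes \<Omega>: "open \<Omega>" and f: "slice_regular_on f \<Omega>" and I: "I \<in> imag_units" and z: "slice_emb I z \<in> \<Omega>"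
  shows "((\<lambda>z. f (slice_emb I z)) has_derivative (\<lambda>t. slice_emb I t * slice_deriv f (slice_emb I z))) (at z)"
    and "deriv (\<lambda>z. slice_coord I w (f (slice_emb I z))) z = slice_coord I w (slice_deriv f (slice_emb I z))"
proof -
  have zU: "z \<in> slice_emb I -` \<Omega>" using z by simp
  from slice_hol_has_derivative[OF I open_vimage_slice_emb[OF \<Omega>] zU slice_regular_imp_holomorphic[OF \<Omega> f I]]
  obtain d where d: "((\<lambda>z. f (slice_emb I z)) has_derivative (\<lambda>t. slice_emb I t * d)) (at z)"
      "\<And>w. deriv (\<lambda>z. slice_coord I w (f (slice_emb I z))) z = slice_coord I w d"
    by metis
  have dI: "slice_dx f I (Re z) (Im z) = d"
    using slice_partials_of_derivative(1)[of f I d "Re z" "Im z"] d(1)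
    unfolding slice_dx_def by (simp add: vector_derivative_at)
  have half: "(1/2) *\<^sub>R (slice_dx f J x y - J * slice_dy f J x y) = d"
    if J: "J \<in> imag_units" and eq: "slice_emb I z = slice_pt J x y" for J x y
  proof -
    have "Complex x y \<in> slice_emb J -` \<Omega>" using z eq by (simp add: slice_emb_Complex)
    from slice_hol_has_derivative[OF J open_vimage_slice_emb[OF \<Omega>] this slice_regular_imp_holomorphic[OF \<Omega> f J]]
    obtain e where "((\<lambda>z. f (slice_emb J z)) has_derivative (\<lambda>t. slice_emb J t * e)) (at (Complex x y))"
      by metis
    from slice_partials_of_derivative[OF this]
    have e: "slice_dx f J x y = e" "slice_dy f J x y = J * e"
      unfolding slice_dx_def slice_dy_def by (simp_all add: vector_derivative_at)
    have "qRe (slice_emb I z) = qRe (slice_pt J x y)" using eq by simp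
    then have x: "Re z = x" using I J by (simp add: slice_emb_alt slice_pt_def imag_units_iff)
    then have "slice_pt J t y = slice_pt I t (Im z)" for t
      using eq by (simp add: slice_emb_def slice_pt_def)
    then have "slice_dx f J x y = d"
      unfolding dI[symmetric] x slice_dx_def by simp
    then show ?thesis
      unfolding e by (simp add: mult.assoc[symmetric] imag_unit_square[OF J] flip: scaleR_2)
  qed
  have "slice_deriv f (slice_emb I z) = d"
    unfolding slice_deriv_def
  proof (rule the_equality)
    fix d' assume "\<forall>x y. \<forall>J\<in>imag_units. slice_emb I z = slice_pt J x y \<longrightarrow>
       d' = (1/2) *\<^sub>R (slice_dx f J x y - J * slice_dy f J x y)"
    then show "d' = d" using half[OF I, of "Re z" "Im z"] I by (simp add: slice_emb_def)
  qed (use half in auto)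
  then show "((\<lambda>z. f (slice_emb I z)) has_derivative (\<lambda>t. slice_emb I t * slice_deriv f (slice_emb I z))) (at z)"
    "deriv (\<lambda>z. slice_coord I w (f (slice_emb I z))) z = slice_coord I w (slice_deriv f (slice_emb I z))"
    using d by simp_all
qed

lemma slice_regular_monomial:
  assumes "open \<Omega>"
  shows "slice_regular_on (\<lambda>q. q ^ n * u) \<Omega>"
  unfolding slice_regular_iff_holomorphic[OF assms]
proof (intro ballI allI)
  fix I w assume I: "I \<in> imag_units"
  show "(\<lambda>z. slice_coord I w (slice_emb I z ^ n * u)) holomorphic_on slice_emb I -` \<Omega>"
    unfolding slice_emb_power[OF I, symmetric] slice_coord_slice_emb_mult[OF I]
    by (intro holomorphic_intros)
qed

lemma slice_regular_slice_deriv: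
  assumes \<Omega>: "open \<Omega>" and f: "slice_regular_on f \<Omega>"
  shows "slice_regular_on (slice_deriv f) \<Omega>"
  unfolding slice_regular_iff_holomorphic[OF \<Omega>]
proof (intro ballI allI)
  fix I w assume I: "I \<in> imag_units"
  show "(\<lambda>z. slice_coord I w (slice_deriv f (slice_emb I z))) holomorphic_on slice_emb I -` \<Omega>"
    by (rule holomorphic_transform[OF holomorphic_deriv[OF slice_regular_imp_holomorphic[OF \<Omega> f I]
            open_vimage_slice_emb[OF \<Omega>]]])
      (simp add: slice_deriv_works(2)[OF \<Omega> f I])
qed

lemma slice_regular_higher_slice_deriv:
  assumes \<Omega>: "open \<Omega>" and f: "slice_regular_on f \<Omega>"
  shows "slice_regular_on ((slice_deriv ^^ k) f) \<Omega>"
  by (induction k) (simp_all add: f slice_regular_slice_deriv[OF \<Omega>])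

lemma higher_deriv_slice_coord:
  assumes \<Omega>: "open \<Omega>" and f: "slice_regular_on f \<Omega>" and I: "I \<in> imag_units" and z: "slice_emb I z \<in> \<Omega>"
  shows "(deriv ^^ k) (\<lambda>z. slice_coord I w (f (slice_emb I z))) z = slice_coord I w ((slice_deriv ^^ k) f (slice_emb I z))"
  using z
proof (induction k arbitrary: z)
  case (Suc k)
  note hol = slice_regular_imp_holomorphic[OF \<Omega> f I, of w] and U = open_vimage_slice_emb[OF \<Omega>, of I]
  have "deriv ((deriv ^^ k) (\<lambda>z. slice_coord I w (f (slice_emb I z)))) z =
    deriv (\<lambda>z. slice_coord I w ((slice_deriv ^^ k) f (slice_emb I z))) z"
    by (rule complex_derivative_transform_within_open[OF holomorphic_higher_deriv[OF hol U]
      slice_regular_imp_holomorphic[OF \<Omega> slice_regular_higher_slice_deriv[OF \<Omega> f] I] U])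
      (use Suc in auto)
  then show ?case
    using slice_deriv_works(2)[OF \<Omega> slice_regular_higher_slice_deriv[OF \<Omega> f] I Suc.prems] by simp
qed simp

section \<open>Slice domains and the identity principle\<close>

lemma slice_domain_open: "axially_symmetric_slice_domain \<Omega> \<Longrightarrow> open \<Omega>"
  by (simp add: axially_symmetric_slice_domain_def)

lemma slice_domain_symmetric:
  assumes "axially_symmetric_slice_domain \<Omega>" "I \<in> imag_units" "slice_emb I z \<in> \<Omega>" "J \<in> imag_units"
  shows "slice_emb J z \<in> \<Omega>"
  using assms unfolding axially_symmetric_slice_domain_def slice_emb_def by blast

lemma slice_domain_vimage_eq:
  assumes "axially_symmetric_slice_domain \<Omega>" "I \<in> imag_units" "J \<in> imag_units"
  shows "slice_emb I -` \<Omega> = slice_emb J -` \<Omega>"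
  using slice_domain_symmetric[OF assms(1)] assms(2,3) by blast

lemma slice_domain_cnj:
  assumes "axially_symmetric_slice_domain \<Omega>" "I \<in> imag_units" "slice_emb I z \<in> \<Omega>"
  shows "slice_emb I (cnj z) \<in> \<Omega>"
  unfolding slice_emb_cnj using slice_domain_symmetric[OF assms] uminus_imag_unit assms(2) by blast

lemma slice_domain_connected_slice:
  assumes D: "axially_symmetric_slice_domain \<Omega>" and I: "I \<in> imag_units"
  shows "connected (slice_emb I -` \<Omega>)"
proof -
  define \<pi> where "\<pi> = (\<lambda>q. of_real (inner q 1) + \<i> * of_real (inner q I))"
  have "qRe I = 0" "inner I I = 1"
    using I norm_imag_unit[OF I] by (auto simp: imag_units_iff simp flip: power2_norm_eq_inner)
  then have \<pi>: "\<pi> (slice_emb I z) = z" for z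
    by (simp add: \<pi>_def slice_emb_alt inner_add_left complex_eq_iff) (simp add: inner_quat_def)
  have "slice_emb I -` \<Omega> = \<pi> ` (\<Omega> \<inter> slice_plane I)"
  proof (intro equalityI subsetI)
    fix z assume "z \<in> slice_emb I -` \<Omega>"
    then have "slice_emb I z \<in> \<Omega> \<inter> slice_plane I"
      by (auto simp: slice_plane_def slice_emb_def)
    then show "z \<in> \<pi> ` (\<Omega> \<inter> slice_plane I)" using \<pi>[of z] by (metis imageI)
  next
    fix z assume "z \<in> \<pi> ` (\<Omega> \<inter> slice_plane I)"
    then obtain x y where xy: "slice_pt I x y \<in> \<Omega>" "z = \<pi> (slice_pt I x y)"
      by (auto simp: slice_plane_def)
    then have "z = Complex x y" using \<pi>[of "Complex x y"] by (simp add: slice_emb_Complex)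
    then show "z \<in> slice_emb I -` \<Omega>" using xy(1) by (simp add: slice_emb_Complex)
  qed
  moreover have "connected (\<pi> ` (\<Omega> \<inter> slice_plane I))"
    unfolding \<pi>_def using D I unfolding axially_symmetric_slice_domain_def
    by (intro connected_continuous_image continuous_intros) blast
  ultimately show ?thesis by simp
qed

text \<open>Every slice meets the real axis of the domain and is connected, so the identity theorem, applied to
  the coordinates on each slice separately, spreads the equality from the real axis to the whole
  domain.\<close>

lemma slice_identity_principle:
  assumes D: "axially_symmetric_slice_domain \<Omega>"
    and f: "slice_regular_on f \<Omega>" and g: "slice_regular_on g \<Omega>"
    and T: "t0 islimpt T" "of_real t0 \<in> \<Omega>" "\<And>t. t \<in> T \<Longrightarrow> of_real t \<in> \<Omega>"
    and eq: "\<And>t. t \<in> T \<Longrightarrow> f (of_real t) = g (of_real t)"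
    and q: "q \<in> \<Omega>"
  shows "f q = g q"
proof -
  obtain I z where Iz: "I \<in> imag_units" "q = slice_emb I z" using quat_slice_emb by metis
  note I = Iz(1) and \<Omega> = slice_domain_open[OF D]
  show ?thesis
  proof (rule slice_coord_eqI[of I])
    fix w
    let ?F = "\<lambda>z. slice_coord I w (f (slice_emb I z)) - slice_coord I w (g (slice_emb I z))"
    have "?F z = 0"
    proof (rule analytic_continuation[where f = ?F and S = "slice_emb I -` \<Omega>" and U = "of_real ` T" and \<xi> = "of_real t0"])
      show "?F holomorphic_on slice_emb I -` \<Omega>"
        by (intro holomorphic_intros slice_regular_imp_holomorphic[OF \<Omega> _ I] f g)
      show "(of_real t0 :: complex) islimpt of_real ` T"
        by (rule islimpt_isCont_image[OF T(1)]) (auto simp: eventually_at_filter)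
    qed (use open_vimage_slice_emb[OF \<Omega>] slice_domain_connected_slice[OF D I] T q Iz(2) eq in auto)
    then show "slice_coord I w (f q) = slice_coord I w (g q)" by (simp add: Iz(2))
  qed
qed

lemma slice_regular_eqI:
  assumes D: "axially_symmetric_slice_domain \<Omega>"
    and f: "slice_regular_on f \<Omega>" and g: "slice_regular_on g \<Omega>"
    and eq: "\<And>t. of_real t \<in> \<Omega> \<Longrightarrow> f (of_real t) = g (of_real t)"
    and q: "q \<in> \<Omega>"
  shows "f q = g q"
proof -
  let ?T = "{t. (of_real t :: quat) \<in> \<Omega>}"
  obtain t0 where t0: "(of_real t0 :: quat) \<in> \<Omega>"
    using D by (auto simp: axially_symmetric_slice_domain_def Reals_def)
  have "open ?T"
    using open_vimage[OF slice_domain_open[OF D], of "of_real"] by (auto simp: vimage_def intro: continuous_intros)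
  then have "t0 islimpt ?T"
    using t0 by (intro interior_limit_point) (simp add: interior_open)
  then show ?thesis
    using slice_identity_principle[OF D f g _ t0 _ _ q] eq by blast
qed

section \<open>Extension from one slice and the representation formula\<close>

text \<open>The representation formula read as a definition: the slice regular function that is given by \<open>u\<close> on the
  slice of \<open>P\<close>. At a real point \<open>sgn (qVec q)\<close> is \<open>0\<close>, but there the difference
  \<open>u z - u (cnj z)\<close> vanishes as well.\<close>

definition slice_ext :: "quat \<Rightarrow> (complex \<Rightarrow> quat) \<Rightarrow> quat \<Rightarrow> quat" where
  "slice_ext P u q = (let z = Complex (qRe q) (norm (qVec q)) in
     (1/2) *\<^sub>R (u z + u (cnj z)) - (1/2) *\<^sub>R (sgn (qVec q) * (P * (u z - u (cnj z)))))"

text \<open>The definition uses the representation \<open>x + y * I\<close> with \<open>y \<ge> 0\<close>; replacing \<open>I\<close> by \<open>- I\<close> and \<open>z\<close> by \<open>cnj z\<close>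
  leaves the formula unchanged.\<close>

lemma slice_ext_slice_emb:
  assumes I: "I \<in> imag_units"
  shows "slice_ext P u (slice_emb I z) =
    (1/2) *\<^sub>R (u z + u (cnj z)) - (1/2) *\<^sub>R (I * (P * (u z - u (cnj z))))"
proof -
  have re: "qRe (slice_emb I z) = Re z" and vec: "qVec (slice_emb I z) = Im z *\<^sub>R I"
    using I by (simp_all add: slice_emb_alt qVec_def imag_units_iff quat_eq_iff)
  have s: "sgn (qVec (slice_emb I z)) = sgn (Im z) *\<^sub>R I" "norm (qVec (slice_emb I z)) = \<bar>Im z\<bar>"
    unfolding vec using norm_imag_unit[OF I] by (simp_all add: sgn_div_norm real_sgn_eq)
  consider "Im z = 0" | "Im z > 0" | "Im z < 0" by linarith
  then show ?thesis
  proof cases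
    case 1
    then have "cnj z = z" by (simp add: complex_eq_iff)
    moreover have "Complex (Re z) \<bar>Im z\<bar> = z" using 1 by (simp add: complex_eq_iff)
    ultimately show ?thesis unfolding slice_ext_def Let_def s re by simp
  next
    case 2
    then have "Complex (Re z) \<bar>Im z\<bar> = z" by (simp add: complex_eq_iff)
    then show ?thesis using 2 unfolding slice_ext_def Let_def s re by simp
  next
    case 3
    then have "Complex (Re z) \<bar>Im z\<bar> = cnj z" by (simp add: complex_eq_iff)
    then show ?thesis using 3 unfolding slice_ext_def Let_def s re
      by (simp add: algebra_simps)
  qed
qed

lemma slice_ext_same_slice:
  assumes P: "P \<in> imag_units"
  shows "slice_ext P u (slice_emb P z) = u z"
  unfolding slice_ext_slice_emb[OF P] mult.assoc[symmetric] imag_unit_square[OF P]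
  by (simp add: algebra_simps flip: scaleR_2)

text \<open>Since \<open>I * (1 - I * P) = (1 - I * P) * P\<close>, left multiplication by \<open>1 - I * P\<close> carries the complex structure of
  the slice of \<open>P\<close> to that of the slice of \<open>I\<close>. A coordinate for the latter thus becomes a
  coordinate for the former.\<close>

lemma slice_coord_intertwine:
  assumes I: "I \<in> imag_units" and P: "P \<in> imag_units"
  shows "slice_coord I w ((1 - I * P) * v) = slice_coord P (qcnj (1 - I * P) * w) v"
proof -
  have "qcnj (1 - I * P) = 1 - P * I"
    using qcnj_imag_unit[OF I] qcnj_imag_unit[OF P] by (simp add: qcnj_diff qcnj_mult) (simp add: quat_eq_iff)
  moreover have "(1 - P * I) * (I * w) = P * ((1 - P * I) * w)"
    by (simp add: left_diff_distrib right_diff_distrib mult.assoc imag_unit_mult_twice[OF I] imag_unit_mult_twice[OF P])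
  ultimately show ?thesis
    by (simp add: slice_coord_def inner_mult_left_adjoint)
qed

lemma slice_coord_uminus: "slice_coord (- P) w v = cnj (slice_coord P w v)"
  by (simp add: slice_coord_def complex_eq_iff)

text \<open>On the slice of \<open>I\<close> the extension is the mean of \<open>(1 - I * P) * u z\<close> and \<open>(1 + I * P) * u (cnj z)\<close>. Both
  summands are holomorphic for the structure of \<open>I\<close>; for the second, \<open>z \<mapsto> u (cnj z)\<close> is holomorphic for
  the structure of \<open>- P\<close>.\<close>

lemma slice_regular_slice_ext:
  assumes D: "axially_symmetric_slice_domain \<Omega>" and P: "P \<in> imag_units"
    and u: "\<And>w. (\<lambda>z. slice_coord P w (u z)) holomorphic_on slice_emb P -` \<Omega>"
  shows "slice_regular_on (slice_ext P u) \<Omega>"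
  unfolding slice_regular_iff_holomorphic[OF slice_domain_open[OF D]]
proof (intro ballI allI)
  fix I w assume I: "I \<in> imag_units"
  have P': "- P \<in> imag_units" using uminus_imag_unit[OF P] .
  let ?a = "qcnj (1 - I * P) * w" and ?b = "qcnj (1 - I * (- P)) * w"
  have split: "slice_ext P u (slice_emb I z) = (1/2) *\<^sub>R ((1 - I * P) * u z + (1 - I * (- P)) * u (cnj z))" for z
    unfolding slice_ext_slice_emb[OF I] by (simp add: algebra_simps)
  have eq: "slice_coord I w (slice_ext P u (slice_emb I z)) =
     (slice_coord P ?a (u z) + cnj (slice_coord P ?b (u (cnj z)))) / 2" for z
    unfolding split slice_coord_scaleR slice_coord_add slice_coord_intertwine[OF I P]
      slice_coord_intertwine[OF I P'] slice_coord_uminus by simp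
  have "(\<lambda>z. cnj (slice_coord P ?b (u (cnj z)))) holomorphic_on slice_emb P -` \<Omega>"
  proof -
    have "cnj ` (slice_emb P -` \<Omega>) \<subseteq> slice_emb P -` \<Omega>"
      using slice_domain_cnj[OF D P] by auto
    from holomorphic_on_compose_cnj_cnj[OF holomorphic_on_subset[OF u this]
        open_vimage_slice_emb[OF slice_domain_open[OF D]]]
    show ?thesis by (simp add: o_def)
  qed
  then show "(\<lambda>z. slice_coord I w (slice_ext P u (slice_emb I z))) holomorphic_on slice_emb I -` \<Omega>"
    unfolding slice_domain_vimage_eq[OF D I P] eq by (intro holomorphic_intros u) auto
qed

text \<open>Both sides are slice regular and coincide on the real axis.\<close>

lemma representation_formula:
  assumes D: "axially_symmetric_slice_domain \<Omega>" and f: "slice_regular_on f \<Omega>"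
    and P: "P \<in> imag_units" and I: "I \<in> imag_units" and z: "slice_emb I z \<in> \<Omega>"
  shows "f (slice_emb I z) = (1/2) *\<^sub>R (f (slice_emb P z) + f (slice_emb P (cnj z)))
    - (1/2) *\<^sub>R (I * (P * (f (slice_emb P z) - f (slice_emb P (cnj z)))))"
proof -
  have reg: "slice_regular_on (slice_ext P (\<lambda>z. f (slice_emb P z))) \<Omega>"
    by (rule slice_regular_slice_ext[OF D P slice_regular_imp_holomorphic[OF slice_domain_open[OF D] f P]])
  have "f (slice_emb I z) = slice_ext P (\<lambda>z. f (slice_emb P z)) (slice_emb I z)"
  proof (rule slice_regular_eqI[OF D f reg _ z])
    fix t :: real
    show "f (of_real t) = slice_ext P (\<lambda>z. f (slice_emb P z)) (of_real t)"
      using slice_ext_same_slice[OF P, of "\<lambda>z. f (slice_emb P z)" "of_real t"] by simp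
  qed
  then show ?thesis by (simp add: slice_ext_slice_emb[OF I])
qed

lemma slice_regular_stem:
  assumes D: "axially_symmetric_slice_domain \<Omega>" and f: "slice_regular_on f \<Omega>"
    and P: "P \<in> imag_units" and z: "slice_emb P z \<in> \<Omega>"
  obtains b c where "\<And>I. I \<in> imag_units \<Longrightarrow> f (slice_emb I z) = b + I * c"
proof -
  have "f (slice_emb I z) = (1/2) *\<^sub>R (f (slice_emb P z) + f (slice_emb P (cnj z)))
    + I * ((- 1/2) *\<^sub>R (P * (f (slice_emb P z) - f (slice_emb P (cnj z)))))" if I: "I \<in> imag_units" for I
    unfolding representation_formula[OF D f P I slice_domain_symmetric[OF D P z I]] by simp
  then show ?thesis using that by blast
qed

section \<open>Difference quotients\<close>

text \<open>At points commuting with \<open>p\<close>, the conjugation in the formula for the regular product with \<open>q - p\<close> is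
  trivial, so there the values of a difference quotient are found by ordinary division.\<close>

lemma linear_regular_prod_commuting:
  assumes D: "axially_symmetric_slice_domain \<Omega>" and h: "slice_regular_on h \<Omega>"
    and p: "p \<noteq> 0" "p * q = q * p" and q: "q \<in> \<Omega>"
  shows "((\<lambda>p'. p' - p) \<star> h) q = (q - p) * h q"
proof -
  obtain I where I: "I \<in> imag_units" "q = slice_emb I (Complex (qRe q) (norm (qVec q)))"
    using quat_slice_form[of q] by (metis slice_emb_Complex)
  obtain b c where "\<And>J. J \<in> imag_units \<Longrightarrow> h (slice_emb J (Complex (qRe q) (norm (qVec q)))) = b + J * c"
    using slice_regular_stem[OF D h I(1)] I(2) q by metis
  from linear_regular_prod[OF p(1) this[unfolded slice_emb_Complex]]
  have "((\<lambda>p'. p' - p) \<star> h) q = q * h q - p * h (inverse p * q * p)" .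
  moreover have "inverse p * q * p = q"
    using p by (metis mult.assoc left_inverse mult_1)
  ultimately show ?thesis by (simp add: left_diff_distrib)
qed

text \<open>On the slice through the base point the quotient is an ordinary complex difference quotient with a
  removable singularity; extension from that slice does the rest. In particular no separate
  treatment of the sphere of conjugates of the base point, where the regular inverse of
  \<open>q - p\<close> is singular, becomes necessary.\<close>

lemma slice_quotient_exists:
  assumes D: "axially_symmetric_slice_domain \<Omega>" and f: "slice_regular_on f \<Omega>"
    and P: "P \<in> imag_units" and z0: "slice_emb P z0 \<in> \<Omega>"
  obtains h where "slice_regular_on h \<Omega>"
    "\<And>z. slice_emb P z \<in> \<Omega> \<Longrightarrow> f (slice_emb P z) - f (slice_emb P z0) = slice_emb P (z - z0) * h (slice_emb P z)"
proof -
  note \<Omega> = slice_domain_open[OF D]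
  define u where "u z = (if z = z0 then slice_deriv f (slice_emb P z0)
    else slice_emb P (inverse (z - z0)) * (f (slice_emb P z) - f (slice_emb P z0)))" for z
  have int: "z0 \<in> interior (slice_emb P -` \<Omega>)"
    using z0 open_vimage_slice_emb[OF \<Omega>] by (simp add: interior_open)
  have "(\<lambda>z. slice_coord P w (u z)) holomorphic_on slice_emb P -` \<Omega>" for w
    using pole_lemma[OF slice_regular_imp_holomorphic[OF \<Omega> f P, of w] int]
    by (rule holomorphic_transform)
      (simp add: u_def slice_coord_slice_emb_mult[OF P] slice_coord_diff slice_deriv_works(2)[OF \<Omega> f P z0] divide_inverse mult.commute)
  then have "slice_regular_on (slice_ext P u) \<Omega>"
    by (rule slice_regular_slice_ext[OF D P])
  moreover have "f (slice_emb P z) - f (slice_emb P z0) = slice_emb P (z - z0) * slice_ext P u (slice_emb P z)" for z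
  proof (cases "z = z0")
    case False
    then have "slice_emb P (z - z0) * slice_emb P (inverse (z - z0)) = 1"
      by (simp flip: slice_emb_mult[OF P])
    then show ?thesis
      using False by (simp add: slice_ext_same_slice[OF P] u_def mult.assoc[symmetric])
  qed simp
  ultimately show ?thesis using that by blast
qed

text \<open>Both sides have the form \<open>b + I * c\<close> with \<open>b\<close> and \<open>c\<close> independent of \<open>I\<close>, so it suffices to compare them for
  \<open>I = P\<close> and \<open>I = - P\<close>, that is, on the slice through \<open>p\<close>.\<close>

lemma linear_regular_prod_from_slice:
  assumes D: "axially_symmetric_slice_domain \<Omega>" and f: "slice_regular_on f \<Omega>" and h: "slice_regular_on h \<Omega>"
    and P: "P \<in> imag_units" and p: "p = slice_emb P z0"
    and eq: "\<And>z. slice_emb P z \<in> \<Omega> \<Longrightarrow> f (slice_emb P z) - a = slice_emb P (z - z0) * h (slice_emb P z)"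
    and q: "q \<in> \<Omega>"
  shows "f q - a = ((\<lambda>p'. p' - p) \<star> h) q"
proof -
  define x y where "x = qRe q" and "y = norm (qVec q)"
  obtain I where I: "I \<in> imag_units" "q = slice_pt I x y" "qVec q \<noteq> 0 \<Longrightarrow> I = sgn (qVec q)"
    using quat_slice_form[of q] unfolding x_def y_def by blast
  have qI: "q = slice_emb I (Complex x y)" using I(2) by (simp add: slice_emb_Complex)
  have qP: "slice_emb P (Complex x y) \<in> \<Omega>" using slice_domain_symmetric[OF D I(1) _ P] q qI by metis
  obtain b c where hb: "\<And>J. J \<in> imag_units \<Longrightarrow> h (slice_emb J (Complex x y)) = b + J * c"
    using slice_regular_stem[OF D h P qP] by blast
  obtain b' c' where fb: "\<And>J. J \<in> imag_units \<Longrightarrow> f (slice_emb J (Complex x y)) = b' + J * c'"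
    using slice_regular_stem[OF D f P qP] by blast
  define m where "m = of_real x - p"
  note PP = imag_unit_mult_twice[OF P]
  have "p * P = P * p"
    using slice_emb_commute[OF P, of z0 \<i>] by (simp add: p)
  then have mP: "m * P = P * m"
    unfolding m_def by (simp add: left_diff_distrib right_diff_distrib of_real_commute_quat)
  have mP': "m * (P * r) = P * (m * r)" for r
    using mP by (metis mult.assoc)
  have 1: "b' + P * c' - a = (m + y *\<^sub>R P) * (b + P * c)"
    using eq[OF qP] unfolding fb[OF P] hb[OF P] slice_emb_diff p[symmetric]
    by (simp add: slice_emb_alt m_def algebra_simps)
  have "slice_emb P (cnj (Complex x y)) \<in> \<Omega>"
    using slice_domain_cnj[OF D P qP] .
  from eq[OF this] have 2: "b' - P * c' - a = (m - y *\<^sub>R P) * (b - P * c)"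
    unfolding slice_emb_diff p[symmetric] unfolding slice_emb_cnj fb[OF uminus_imag_unit[OF P]] hb[OF uminus_imag_unit[OF P]]
    by (simp add: slice_emb_alt m_def algebra_simps)
  have e1: "(m + y *\<^sub>R P) * (b + P * c) = (m * b - y *\<^sub>R c) + P * (m * c + y *\<^sub>R b)"
    by (simp add: algebra_simps mP' PP)
  have e2: "(m - y *\<^sub>R P) * (b - P * c) = (m * b - y *\<^sub>R c) - P * (m * c + y *\<^sub>R b)"
    by (simp add: algebra_simps mP' PP)
  have "X = A \<and> Y = B" if "X + Y = A + B" "X - Y = A - B" for X Y A B :: quat
    using that by (auto simp: quat_eq_iff)
  from this[of "b' - a" "P * c'" "m * b - y *\<^sub>R c" "P * (m * c + y *\<^sub>R b)"]
  have s: "b' - a = m * b - y *\<^sub>R c" and "P * c' = P * (m * c + y *\<^sub>R b)"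
    using 1 2 unfolding e1 e2 by (simp_all add: algebra_simps)
  then have t: "c' = m * c + y *\<^sub>R b"
    by (metis PP neg_equal_iff_equal)
  have lin: "slice_pt J x y - p = m + J * of_real y" for J
    by (simp add: slice_pt_def m_def of_real_commute_quat)
  have "((\<lambda>p'. p' - p) \<star> h) q = (m * b - of_real y * c) + I * (m * c + of_real y * b)"
    by (rule regular_prod_slice_form[OF _ _ I(1) I(2)[unfolded x_def y_def] I(3)])
      (simp_all add: lin hb[unfolded slice_emb_Complex] flip: x_def y_def)
  also have "\<dots> = b' - a + I * c'" unfolding s t by (simp add: scaleR_conv_of_real)
  also have "\<dots> = f q - a" unfolding qI fb[OF I(1)] by simp
  finally show ?thesis by simp
qed

text \<open>Uniqueness of the quotient holds because its values at real points, which differ from the nonreal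
  base point, are determined by division.\<close>

lemma diff_quot_properties:
  assumes D: "axially_symmetric_slice_domain \<Omega>" and f: "slice_regular_on f \<Omega>"
    and P: "P \<in> imag_units" and z0: "slice_emb P z0 \<in> \<Omega>" "Im z0 \<noteq> 0"
  defines "p \<equiv> slice_emb P z0"
  shows "slice_regular_on (diff_quot \<Omega> p f) \<Omega>"
    and "slice_emb P z \<in> \<Omega> \<Longrightarrow> f (slice_emb P z) - f p = slice_emb P (z - z0) * diff_quot \<Omega> p f (slice_emb P z)"
proof -
  note \<Omega> = slice_domain_open[OF D]
  let ?Q = "\<lambda>h. slice_regular_on h \<Omega> \<and> (\<forall>q\<in>\<Omega>. f q - f p = ((\<lambda>p'. p' - p) \<star> h) q) \<and> (\<forall>q. q \<notin> \<Omega> \<longrightarrow> h q = 0)"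
  have p0: "p \<noteq> 0"
    using norm_slice_emb[OF P, of z0] z0(2) by (auto simp: p_def)
  have on_slice: "f (slice_emb P z) - f p = slice_emb P (z - z0) * h (slice_emb P z)"
    if "?Q h" "slice_emb P z \<in> \<Omega>" for h z
  proof -
    have "p * slice_emb P z = slice_emb P z * p"
      unfolding p_def by (rule slice_emb_commute[OF P])
    then have "((\<lambda>p'. p' - p) \<star> h) (slice_emb P z) = (slice_emb P z - p) * h (slice_emb P z)"
      using that by (intro linear_regular_prod_commuting[OF D _ p0]) auto
    moreover have "f (slice_emb P z) - f p = ((\<lambda>p'. p' - p) \<star> h) (slice_emb P z)"
      using that by blast
    ultimately show ?thesis
      unfolding slice_emb_diff p_def by (rule trans[rotated])
  qed
  obtain h where h: "slice_regular_on h \<Omega>"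
    "\<And>z. slice_emb P z \<in> \<Omega> \<Longrightarrow> f (slice_emb P z) - f (slice_emb P z0) = slice_emb P (z - z0) * h (slice_emb P z)"
    using slice_quotient_exists[OF D f P z0(1)] by metis
  define h0 where "h0 q = (if q \<in> \<Omega> then h q else 0)" for q
  have h0: "slice_regular_on h0 \<Omega>"
    using slice_regular_cong[OF \<Omega> h(1)] by (simp add: h0_def)
  have "f q - f p = ((\<lambda>p'. p' - p) \<star> h0) q" if "q \<in> \<Omega>" for q
    by (rule linear_regular_prod_from_slice[OF D f h0 P p_def[THEN meta_eq_to_obj_eq] _ that])
      (use h(2) in \<open>simp add: h0_def p_def\<close>)
  then have ex: "?Q h0" using h0 by (auto simp: h0_def)
  have uniq: "h1 = h2" if h1: "?Q h1" and h2: "?Q h2" for h1 h2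
  proof
    fix q
    have "h1 q = h2 q" if "q \<in> \<Omega>"
    proof (rule slice_regular_eqI[OF D _ _ _ that])
      fix t :: real assume t: "of_real t \<in> \<Omega>"
      have "of_real t - z0 \<noteq> 0" using z0(2) by (auto simp: complex_eq_iff)
      then have "slice_emb P (of_real t - z0) \<noteq> 0"
        using norm_slice_emb[OF P, of "of_real t - z0"] by auto
      then show "h1 (of_real t) = h2 (of_real t)"
        using on_slice[OF h1, of "of_real t"] on_slice[OF h2, of "of_real t"] t by simp
    qed (use h1 h2 in auto)
    then show "h1 q = h2 q" using h1 h2 by metis
  qed
  have "?Q (diff_quot \<Omega> p f)"
    unfolding diff_quot_def by (rule theI[of ?Q, OF ex]) (rule uniq[OF _ ex])
  then show "slice_regular_on (diff_quot \<Omega> p f) \<Omega>"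
    "slice_emb P z \<in> \<Omega> \<Longrightarrow> f (slice_emb P z) - f p = slice_emb P (z - z0) * diff_quot \<Omega> p f (slice_emb P z)"
    using on_slice by blast+
qed

section \<open>The boundary expression is a radial derivative\<close>

text \<open>Over the sphere of imaginary units, \<open>qRe (K * B)\<close> is minus the scalar product of \<open>K\<close> with the vector part of
  \<open>B\<close>. Unless that vector part is zero, the maximum is attained only in the direction opposite to it; in
  both cases it is a real multiple of \<open>P\<close>.\<close>

lemma qRe_maximal_imp_commute:
  assumes P: "P \<in> imag_units" and max: "\<And>K. K \<in> imag_units \<Longrightarrow> qRe (K * B) \<le> qRe (P * B)"
  shows "P * B = B * P"
proof -
  define V where "V = qVec B"
  have B: "B = of_real (qRe B) + V"
    by (simp add: V_def qVec_def quat_eq_iff)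
  have re: "qRe (K * B) = - inner K V" if "K \<in> imag_units" for K
    using that by (simp add: V_def qVec_def inner_quat_def imag_units_iff)
  have "V = - (norm V *\<^sub>R P)"
  proof (cases "V = 0")
    case False
    \<comment> \<open>The maximal value over all \<open>K\<close> is \<open>norm V\<close>, taken at \<open>- sgn V\<close>; maximality of \<open>P\<close> gives equality in Cauchy-Schwarz.\<close>
    have nV: "(norm V)\<^sup>2 = (qIm1 B)\<^sup>2 + (qIm2 B)\<^sup>2 + (qIm3 B)\<^sup>2"
      unfolding norm_quat_square by (simp add: V_def qVec_def)
    have "(qIm1 B / norm V)\<^sup>2 + (qIm2 B / norm V)\<^sup>2 + (qIm3 B / norm V)\<^sup>2 = (norm V)\<^sup>2 / (norm V)\<^sup>2"
      unfolding nV power_divide add_divide_distrib by (simp only: nV)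
    then have "(qIm1 B / norm V)\<^sup>2 + (qIm2 B / norm V)\<^sup>2 + (qIm3 B / norm V)\<^sup>2 = 1"
      using False by simp
    moreover have "- sgn V = (- 1 / norm V) *\<^sub>R V" by (simp add: sgn_div_norm divide_inverse)
    ultimately have K: "- sgn V \<in> imag_units"
      unfolding imag_units_iff by (simp add: V_def qVec_def)
    have "inner (- sgn V) V = - norm V"
      using False by (simp add: sgn_div_norm dot_square_norm power2_eq_square)
    then have "inner P V \<le> - norm V"
      using max[OF K] unfolding re[OF K] re[OF P] by simp
    then have "norm V * inner P V \<le> norm V * - norm V"
      by (intro mult_left_mono) auto
    moreover have "(norm (V + norm V *\<^sub>R P))\<^sup>2 = (norm V)\<^sup>2 + 2 * (norm V * inner P V) + (norm V)\<^sup>2 * (norm P)\<^sup>2"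
      unfolding power2_norm_eq_inner[of "V + norm V *\<^sub>R P"]
      by (simp add: inner_add_left inner_add_right inner_commute[of V P] dot_square_norm[of V] dot_square_norm[of P] power2_eq_square algebra_simps)
    ultimately have "(norm (V + norm V *\<^sub>R P))\<^sup>2 \<le> 0"
      by (simp add: norm_imag_unit[OF P] power2_eq_square)
    then have "V + norm V *\<^sub>R P = 0" by simp
    then show ?thesis by (rule eq_neg_iff_add_eq_0[THEN iffD2])
  qed simp
  then have "P * V = V * P"
    by (metis mult_minus_left mult_minus_right mult_scaleR_left mult_scaleR_right)
  then have "P * (of_real (qRe B) + V) = (of_real (qRe B) + V) * P"
    by (simp add: distrib_left distrib_right of_real_commute_quat)
  then show ?thesis
    using B by metis
qed

text \<open>Up to the factor two, the map \<open>q \<mapsto> q - P * q * P\<close> is the orthogonal projection to the plane spanned by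
  \<open>1\<close> and \<open>P\<close>.\<close>

lemma slice_plane_projection:
  assumes P: "P \<in> imag_units"
  shows "q - P * q * P = (2 * qRe q) *\<^sub>R 1 - (2 * qRe (q * P)) *\<^sub>R P"
proof -
  have P0: "qRe P = 0" and P1: "qIm1 P * qIm1 P + qIm2 P * qIm2 P + qIm3 P * qIm3 P = 1"
    using P by (auto simp: imag_units_iff power2_eq_square)
  show ?thesis
    unfolding quat_eq_iff
    by (intro conjI; simp add: P0; use P1 in algebra)
qed

text \<open>The meaning of the commutator. Let \<open>u\<close> come from the slice derivative at \<open>\<xi>\<close> and \<open>v\<close> from the variation of \<open>f\<close>
  along the sphere of conjugates of \<open>\<xi>\<close>. As \<open>v\<close> lies in the slice of \<open>P\<close>, the commutator removes from
  \<open>qcnj u\<close> exactly its part orthogonal to the slice. What remains is the projection of \<open>u\<close> to the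
  slice, and its product with \<open>\<xi>\<close> is real by the tangential condition.\<close>

lemma boundary_identity:
  assumes P: "P \<in> imag_units" and y: "y \<noteq> 0" and \<xi>: "\<xi> = slice_pt P x y"
    and tang: "qRe (\<xi> * u * P) = 0" and comm: "P * v = v * P"
    and second: "u - v = (2 * y) *\<^sub>R (P * Q)"
  shows "qcnj \<xi> * (qcnj u + qcomm (qcnj \<xi>) (qcnj Q)) = of_real (qRe (\<xi> * u))"
proof -
  have cP: "qcnj P = - P" using qcnj_imag_unit[OF P] .
  have PP: "P * P = - 1" using imag_unit_square[OF P] .
  have \<xi>P: "\<xi> * P = P * \<xi>"
    using slice_emb_commute[OF P, of "Complex x y" \<i>] by (simp add: \<xi> slice_emb_Complex)
  have c\<xi>: "qcnj \<xi> = of_real x - y *\<^sub>R P"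
    using P by (auto simp: \<xi> slice_pt_def imag_units_iff quat_eq_iff)
  have cv: "P * qcnj v * P = - qcnj v"
  proof -
    have "P * qcnj v = qcnj v * P"
      using arg_cong[OF comm, of qcnj] by (simp add: qcnj_mult cP)
    then show ?thesis by (simp add: mult.assoc PP)
  qed
  have "qcnj u - qcnj v = - ((2 * y) *\<^sub>R (qcnj Q * P))"
    using arg_cong[OF second, of qcnj] cP by (simp add: qcnj_diff qcnj_mult qcnj_scaleR)
  then have QP: "y *\<^sub>R (qcnj Q * P) = (-1/2) *\<^sub>R (qcnj u - qcnj v)" by simp
  have "y *\<^sub>R (P * qcnj Q) = - (P * (y *\<^sub>R (qcnj Q * P)) * P)"
    by (simp add: mult.assoc PP)
  also have "\<dots> = (1/2) *\<^sub>R (P * qcnj u * P + qcnj v)"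
    unfolding QP using cv by (simp add: left_diff_distrib right_diff_distrib scaleR_right_diff_distrib scaleR_right_distrib)
  finally have PQ: "y *\<^sub>R (P * qcnj Q) = (1/2) *\<^sub>R (P * qcnj u * P + qcnj v)" .
  have "qcomm (qcnj \<xi>) (qcnj Q) = y *\<^sub>R (qcnj Q * P) - y *\<^sub>R (P * qcnj Q)"
    unfolding qcomm_def c\<xi> by (simp add: left_diff_distrib right_diff_distrib of_real_commute_quat)
  also have "\<dots> = (-1/2) *\<^sub>R (P * qcnj u * P + qcnj u)"
    unfolding QP PQ by (simp add: scaleR_right_diff_distrib scaleR_right_distrib add.commute)
  finally have comm_eq: "qcomm (qcnj \<xi>) (qcnj Q) = (-1/2) *\<^sub>R (P * qcnj u * P + qcnj u)" .
  have "X + (-1/2) *\<^sub>R (Y + X) = (1/2) *\<^sub>R (X - Y)" for X Y :: quat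
    by (auto simp: quat_eq_iff field_simps)
  then have "qcnj u + qcomm (qcnj \<xi>) (qcnj Q) = (1/2) *\<^sub>R (qcnj u - P * qcnj u * P)"
    unfolding comm_eq .
  also have "\<dots> = (1/2) *\<^sub>R qcnj (u - P * u * P)"
    by (simp add: qcnj_diff qcnj_mult cP mult.assoc)
  finally have "qcnj \<xi> * (qcnj u + qcomm (qcnj \<xi>) (qcnj Q)) = (1/2) *\<^sub>R qcnj ((u - P * u * P) * \<xi>)"
    by (simp add: qcnj_mult)
  also have "(u - P * u * P) * \<xi> = \<xi> * (u - P * u * P)"
    unfolding slice_plane_projection[OF P]
    by (simp add: left_diff_distrib right_diff_distrib \<xi>P)
  also have "\<xi> * (u - P * u * P) = \<xi> * u - P * (\<xi> * u) * P"
    using \<xi>P by (metis mult.assoc right_diff_distrib)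
  also have "\<dots> = (2 * qRe (\<xi> * u)) *\<^sub>R 1"
    unfolding slice_plane_projection[OF P] tang by simp
  finally show ?thesis by (simp add: quat_eq_iff)
qed

text \<open>By the symmetry of the domain, \<open>\<xi> \<in> \<Omega>\<close> places the whole sphere of conjugates of \<open>\<xi>\<close> in \<open>\<Omega>\<close>.\<close>

locale boundary_point =
  fixes f :: "quat \<Rightarrow> quat" and \<xi> :: quat and \<Omega> :: "quat set"
  assumes norm_\<xi>: "norm \<xi> = 1"
    and D: "axially_symmetric_slice_domain \<Omega>"
    and ball_sub: "ball 0 1 \<subseteq> \<Omega>" and \<xi>_in: "\<xi> \<in> \<Omega>"
    and f: "slice_regular_on f \<Omega>"
    and f_ball: "f ` ball 0 1 \<subseteq> ball 0 1"
    and f_\<xi>: "norm (f \<xi>) = 1"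
begin

lemmas \<Omega>_open = slice_domain_open[OF D]

lemma ball_subset_slice: "I \<in> imag_units \<Longrightarrow> ball 0 1 \<subseteq> slice_emb I -` \<Omega>"
  using ball_sub by (force simp: norm_slice_emb subset_iff)

lemma norm_f_le: "I \<in> imag_units \<Longrightarrow> norm z < 1 \<Longrightarrow> norm (f (slice_emb I z)) \<le> 1"
  using image_subset_iff[THEN iffD1, OF f_ball, rule_format, of "slice_emb I z"] norm_slice_emb[of I z] by simp

text \<open>Coordinates with respect to \<open>w\<close> of norm at most \<open>1\<close> map the disc into the closed disc, so that the classical
  theory applies to them.\<close>

lemma norm_coord_le:
  assumes "I \<in> imag_units" "norm w \<le> 1" "norm z < 1"
  shows "norm (slice_coord I w (f (slice_emb I z))) \<le> 1"
  using norm_slice_coord_le[OF assms(1), of w "f (slice_emb I z)"] norm_f_le[OF assms(1,3)] assms(2)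
  by (meson dual_order.trans mult_le_one norm_ge_zero)

lemmas coord_holomorphic = slice_regular_imp_holomorphic[OF \<Omega>_open f]

lemma norm_f_sphere_le:
  assumes I: "I \<in> imag_units" and z: "slice_emb I z \<in> \<Omega>" "norm z = 1"
  shows "norm (f (slice_emb I z)) \<le> 1"
proof (cases "f (slice_emb I z) = 0")
  case False
  define w where "w = sgn (f (slice_emb I z))"
  have w: "norm w = 1" using False by (simp add: w_def norm_sgn)
  have "f (slice_emb I z) = norm (f (slice_emb I z)) *\<^sub>R w"
    using False by (simp add: w_def sgn_div_norm)
  then have "slice_coord I w (f (slice_emb I z)) = of_real (norm (f (slice_emb I z)))"
    using w by (metis slice_coord_scaleR slice_coord_self[OF I] mult.right_neutral of_real_1 one_power2)
  moreover have "norm (slice_coord I w (f (slice_emb I z))) \<le> 1"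
    by (rule disc_bound_extends[OF holomorphic_on_imp_continuous_on[OF coord_holomorphic[OF I, of w]]
      ball_subset_slice[OF I]]) (use norm_coord_le[OF I] w z in auto)
  ultimately show ?thesis by simp
qed simp

text \<open>The coordinate of \<open>f\<close> in the direction of the boundary value \<open>f \<xi>\<close> takes the value \<open>1\<close> at \<open>\<zeta>\<close>. Its radial
  derivative there is that of \<open>norm f\<close>, and its tangential derivative is \<open>0\<close>.\<close>

lemma slice_derivative_tangential:
  assumes P: "P \<in> imag_units" and \<zeta>: "\<xi> = slice_emb P \<zeta>"
  defines "h \<equiv> \<lambda>z. slice_coord P (f \<xi>) (f (slice_emb P z))"
  shows "Re (\<zeta> * deriv h \<zeta> * cnj (h \<zeta>)) = qRe (\<xi> * (slice_deriv f \<xi> * qcnj (f \<xi>)))"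
    and "qRe (\<xi> * (slice_deriv f \<xi> * qcnj (f \<xi>)) * P) = 0"
    and "h \<zeta> = 1" "norm \<zeta> = 1"
proof -
  show n\<zeta>: "norm \<zeta> = 1" using norm_\<xi> \<zeta> norm_slice_emb[OF P] by simp
  show h1: "h \<zeta> = 1"
    by (simp add: h_def \<zeta>[symmetric] slice_coord_self[OF P] f_\<xi>)
  have "deriv h \<zeta> = slice_coord P (f \<xi>) (slice_deriv f \<xi>)"
    unfolding h_def using slice_deriv_works(2)[OF \<Omega>_open f P] \<xi>_in \<zeta> by simp
  then have *: "\<zeta> * deriv h \<zeta> * cnj (h \<zeta>) = slice_coord P (f \<xi>) (\<xi> * slice_deriv f \<xi>)"
    using slice_coord_slice_emb_mult[OF P, of "f \<xi>" \<zeta>] by (simp add: h1 \<zeta>)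
  then show "Re (\<zeta> * deriv h \<zeta> * cnj (h \<zeta>)) = qRe (\<xi> * (slice_deriv f \<xi> * qcnj (f \<xi>)))"
    by (simp add: inner_quat_eq_qRe mult.assoc)
  have "Im (\<zeta> * deriv h \<zeta> * cnj (h \<zeta>)) = 0"
    by (rule boundary_derivative_real[OF _ open_vimage_slice_emb[OF \<Omega>_open] ball_subset_slice[OF P]])
      (use coord_holomorphic[OF P] norm_coord_le[OF P] f_\<xi> \<xi>_in \<zeta> n\<zeta> h1 in \<open>auto simp: h_def\<close>)
  then have "inner (\<xi> * slice_deriv f \<xi>) (P * f \<xi>) = 0"
    unfolding * by (simp add: slice_coord_def)
  then show "qRe (\<xi> * (slice_deriv f \<xi> * qcnj (f \<xi>)) * P) = 0"
    by (simp only: inner_quat_eq_qRe qcnj_mult qcnj_imag_unit[OF P] mult.assoc mult_minus_right quat_uminus_sel neg_equal_0_iff_equal)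
qed

text \<open>A real boundary point lies on every slice, so the tangential condition holds for all imaginary units
  and forces \<open>slice_deriv f \<xi> * qcnj (f \<xi>)\<close> to be real; the commutator is zero.\<close>

lemma boundary_expr_real_point:
  assumes "\<xi> = of_real x"
  shows "boundary_expr \<Omega> \<xi> f = of_real (qRe (\<xi> * (slice_deriv f \<xi> * qcnj (f \<xi>))))"
proof -
  define u where "u = slice_deriv f \<xi> * qcnj (f \<xi>)"
  have "x \<noteq> 0" using norm_\<xi> assms by auto
  have tang: "qRe (\<xi> * u * P) = 0" if "P \<in> imag_units" for P
    using slice_derivative_tangential(2)[OF that, of "of_real x"] assms by (simp add: u_def)
  have "qIm1 u = 0" "qIm2 u = 0" "qIm3 u = 0"
    using tang[of "Quat 0 1 0 0"] tang[of "Quat 0 0 1 0"] tang[of "Quat 0 0 0 1"] assms \<open>x \<noteq> 0\<close>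
    by (auto simp: imag_units_iff)
  moreover have "qcnj \<xi> = of_real x" by (simp add: assms quat_eq_iff)
  moreover have "f \<xi> * qcnj (slice_deriv f \<xi>) = qcnj u" by (simp add: u_def qcnj_mult)
  moreover have "qcomm (of_real x) r = 0" for r
    by (simp add: qcomm_def quat_eq_iff)
  ultimately have "boundary_expr \<Omega> \<xi> f = of_real x * qcnj u" "qcnj u = of_real (qRe u)"
    unfolding boundary_expr_def by (simp, simp add: quat_eq_iff)
  then show ?thesis
    unfolding u_def[symmetric] by (simp add: assms)
qed

text \<open>On the sphere of conjugates of \<open>\<xi>\<close> the function is \<open>b + K * c\<close> with \<open>K\<close> ranging over the imaginary units, its
  norm is at most \<open>1\<close> there, and it equals \<open>1\<close> for \<open>K = P\<close>. This maximality makes \<open>c * qcnj (f \<xi>)\<close>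
  commute with \<open>P\<close>. On the other hand \<open>c\<close> is a real multiple of the value at \<open>qcnj \<xi>\<close> of the first
  difference quotient, whose value at \<open>\<xi>\<close> is the slice derivative; the second difference quotient
  connects the two values, and \<open>boundary_identity\<close> applies.\<close>

lemma boundary_expr_nonreal_point:
  assumes P: "P \<in> imag_units" and \<zeta>: "\<xi> = slice_emb P \<zeta>" "Im \<zeta> \<noteq> 0"
  shows "boundary_expr \<Omega> \<xi> f = of_real (qRe (\<xi> * (slice_deriv f \<xi> * qcnj (f \<xi>))))"
proof -
  define a h1 h2 where "a = f \<xi>" and "h1 = diff_quot \<Omega> \<xi> f" and "h2 = diff_quot \<Omega> (qcnj \<xi>) h1"
  have \<zeta>_in: "slice_emb P \<zeta> \<in> \<Omega>" using \<xi>_in \<zeta> by simp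
  have cnj_in: "slice_emb P (cnj \<zeta>) \<in> \<Omega>" using slice_domain_cnj[OF D P \<zeta>_in] .
  have c\<xi>: "qcnj \<xi> = slice_emb P (cnj \<zeta>)" by (simp add: \<zeta>(1) qcnj_slice_emb[OF P])
  note q1 = diff_quot_properties[OF D f P \<zeta>_in \<zeta>(2), folded \<zeta>(1), folded h1_def a_def]
  have "Im (cnj \<zeta>) \<noteq> 0" using \<zeta>(2) by simp
  note q2 = diff_quot_properties[OF D q1(1) P cnj_in this, folded c\<xi>, folded h2_def]
  have z: "slice_emb P (\<zeta> - cnj \<zeta>) = (2 * Im \<zeta>) *\<^sub>R P"
    by (simp add: slice_emb_alt)
  have z': "slice_emb P (cnj \<zeta> - \<zeta>) = - ((2 * Im \<zeta>) *\<^sub>R P)"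
    by (simp add: slice_emb_alt)
  have second: "h1 \<xi> - h1 (qcnj \<xi>) = (2 * Im \<zeta>) *\<^sub>R (P * h2 \<xi>)"
    using q2(2)[OF \<zeta>_in] by (simp add: z \<zeta>(1)[symmetric])
  have deriv: "slice_deriv f \<xi> = h1 \<xi>"
  proof (rule slice_coord_eqI[of P])
    fix w
    define H where "H = (\<lambda>z. slice_coord P w (h1 (slice_emb P z)))"
    have dH: "(H has_field_derivative deriv H \<zeta>) (at \<zeta>)"
      unfolding H_def by (rule holomorphic_derivI[OF slice_regular_imp_holomorphic[OF \<Omega>_open q1(1) P]
        open_vimage_slice_emb[OF \<Omega>_open]]) (use \<zeta>_in in simp)
    then have "((\<lambda>z. slice_coord P w a + (z - \<zeta>) * H z) has_field_derivative H \<zeta>) (at \<zeta>)"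
      by (auto intro!: derivative_eq_intros)
    then have "((\<lambda>z. slice_coord P w (f (slice_emb P z))) has_field_derivative H \<zeta>) (at \<zeta>)"
    proof (rule has_field_derivative_transform_within_open[OF _ open_vimage_slice_emb[OF \<Omega>_open, of P]])
      fix z assume "z \<in> slice_emb P -` \<Omega>"
      then have "f (slice_emb P z) - a = slice_emb P (z - \<zeta>) * h1 (slice_emb P z)"
        using q1(2) by simp
      then have "slice_coord P w (f (slice_emb P z)) - slice_coord P w a = (z - \<zeta>) * H z"
        unfolding H_def slice_coord_diff[symmetric] slice_coord_slice_emb_mult[OF P, symmetric] by simp
      then show "slice_coord P w a + (z - \<zeta>) * H z = slice_coord P w (f (slice_emb P z))"
        by (simp add: algebra_simps)
    qed (use \<zeta>_in in simp)
    from DERIV_imp_deriv[OF this] slice_deriv_works(2)[OF \<Omega>_open f P \<zeta>_in, of w]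
    show "slice_coord P w (slice_deriv f \<xi>) = slice_coord P w (h1 \<xi>)"
      by (simp add: H_def flip: \<zeta>(1))
  qed
  obtain b c where bc: "\<And>K. K \<in> imag_units \<Longrightarrow> f (slice_emb K \<zeta>) = b + K * c"
    using slice_regular_stem[OF D f P \<zeta>_in] by metis
  have a: "a = b + P * c" using bc[OF P] by (simp add: a_def \<zeta>(1))
  have c: "c = Im \<zeta> *\<^sub>R h1 (qcnj \<xi>)"
  proof -
    have "f (slice_emb P (cnj \<zeta>)) = b - P * c"
      using bc[OF uminus_imag_unit[OF P]] by (simp add: slice_emb_cnj)
    with q1(2)[OF cnj_in] have "(b - P * c) - (b + P * c) = - ((2 * Im \<zeta>) *\<^sub>R (P * h1 (qcnj \<xi>)))"
      by (simp add: z' a c\<xi>)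
    moreover have "X = r *\<^sub>R Y" if "(b - X) - (b + X) = - ((2 * r) *\<^sub>R Y)" for X Y r
      using that by (auto simp: quat_eq_iff)
    ultimately have "P * c = P * (Im \<zeta> *\<^sub>R h1 (qcnj \<xi>))"
      unfolding mult_scaleR_right by blast
    then show ?thesis using imag_unit_mult_twice[OF P] by (metis neg_equal_iff_equal)
  qed
  have "P * (c * qcnj a) = c * qcnj a * P"
  proof (rule qRe_maximal_imp_commute[OF P])
    fix K assume K: "K \<in> imag_units"
    \<comment> \<open>Expanding the square of the norm at \<open>K\<close>, the quadratic term may be dropped because it is nonnegative.\<close>
    have "a + (K - P) * c = b + K * c" by (simp add: a left_diff_distrib)
    then have "norm (a + (K - P) * c) \<le> 1"
      using norm_f_sphere_le[OF K slice_domain_symmetric[OF D P \<zeta>_in K]] bc[OF K]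
        slice_derivative_tangential(4)[OF P \<zeta>(1)]
      by simp
    then have "(norm (a + (K - P) * c))\<^sup>2 \<le> 1" by (simp add: power_le_one)
    moreover have "(norm (a + (K - P) * c))\<^sup>2 = 1 + 2 * inner ((K - P) * c) a + (norm ((K - P) * c))\<^sup>2"
      using f_\<xi> unfolding power2_norm_eq_inner[of "a + _"] inner_add_left inner_add_right
      by (simp add: inner_commute[of a "(K - P) * c"] dot_square_norm flip: a_def)
    ultimately have "inner ((K - P) * c) a \<le> 0"
      using zero_le_power2[of "norm ((K - P) * c)"] by linarith
    then show "qRe (K * (c * qcnj a)) \<le> qRe (P * (c * qcnj a))"
      by (simp only: inner_quat_eq_qRe left_diff_distrib mult.assoc quat_diff_sel)
  qed
  then have comm: "P * (h1 (qcnj \<xi>) * qcnj a) = h1 (qcnj \<xi>) * qcnj a * P"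
    using \<zeta>(2) by (simp add: c)
  have "qcnj \<xi> * (qcnj (slice_deriv f \<xi> * qcnj a) + qcomm (qcnj \<xi>) (qcnj (h2 \<xi> * qcnj a)))
      = of_real (qRe (\<xi> * (slice_deriv f \<xi> * qcnj a)))"
  proof (rule boundary_identity[OF P \<zeta>(2) _ _ comm])
    show "\<xi> = slice_pt P (Re \<zeta>) (Im \<zeta>)" by (simp add: \<zeta>(1) slice_emb_def)
    show "qRe (\<xi> * (slice_deriv f \<xi> * qcnj a) * P) = 0"
      using slice_derivative_tangential(2)[OF P \<zeta>(1)] by (simp add: a_def)
    show "slice_deriv f \<xi> * qcnj a - h1 (qcnj \<xi>) * qcnj a = (2 * Im \<zeta>) *\<^sub>R (P * (h2 \<xi> * qcnj a))"
      unfolding deriv left_diff_distrib[symmetric] second by (simp add: mult.assoc)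
  qed
  then show ?thesis
    unfolding boundary_expr_def h1_def[symmetric] h2_def[symmetric] a_def[symmetric]
    by (simp add: qcnj_mult)
qed

lemma boundary_expr_eq_radial_derivative:
  assumes P: "P \<in> imag_units" and \<zeta>: "\<xi> = slice_emb P \<zeta>"
  shows "boundary_expr \<Omega> \<xi> f = of_real (qRe (\<xi> * (slice_deriv f \<xi> * qcnj (f \<xi>))))"
proof (cases "Im \<zeta> = 0")
  case True
  then have "\<xi> = of_real (Re \<zeta>)" by (simp add: \<zeta> slice_emb_alt)
  then show ?thesis by (rule boundary_expr_real_point)
qed (rule boundary_expr_nonreal_point[OF P \<zeta>])

text \<open>The Schwarz lemma for \<open>f\<close> follows from the one for its coordinates, since some coordinate with respect to a
  quaternion of norm at most \<open>1\<close> attains the norm of any given value.\<close>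

lemma vanishing_order_bounds:
  assumes van: "\<And>k. k < n \<Longrightarrow> (slice_deriv ^^ k) f 0 = 0"
  shows "norm ((slice_deriv ^^ n) f 0) / fact n \<le> 1"
    and "I \<in> imag_units \<Longrightarrow> norm z < 1 \<Longrightarrow> norm (f (slice_emb I z)) \<le> norm z ^ n"
proof -
  have *: "norm ((slice_deriv ^^ n) f 0) / fact n \<le> 1 \<and> (norm z < 1 \<longrightarrow> norm (f (slice_emb I z)) \<le> norm z ^ n)"
    if I: "I \<in> imag_units" for I z
  proof -
    let ?h = "\<lambda>w z. slice_coord I w (f (slice_emb I z))"
    have hol: "?h w holomorphic_on ball 0 1" for w
      by (rule holomorphic_on_subset[OF coord_holomorphic[OF I] ball_subset_slice[OF I]])
    have der: "(deriv ^^ k) (?h w) 0 = slice_coord I w ((slice_deriv ^^ k) f 0)" for k w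
      using higher_deriv_slice_coord[OF \<Omega>_open f I, of 0 k w] subsetD[OF ball_sub, of 0] by simp
    have h0: "(deriv ^^ k) (?h w) 0 = 0" if "k < n" for k w
      using van[OF that] by (simp add: der)
    note bounds = derivative_quotient_le_one[OF hol norm_coord_le[OF I] h0]
    have ex: "\<exists>w. norm w \<le> 1 \<and> norm (slice_coord I w v) = norm v" for v
    proof (cases "v = 0")
      case False
      then have "v = norm v *\<^sub>R sgn v" "norm (sgn v) = 1" by (simp_all add: sgn_div_norm)
      then have "slice_coord I (sgn v) v = of_real (norm v)"
        by (metis slice_coord_scaleR slice_coord_self[OF I] mult.right_neutral of_real_1 one_power2)
      then show ?thesis using \<open>norm (sgn v) = 1\<close> by (intro exI[of _ "sgn v"]) simp
    qed (auto intro: exI[of _ 0])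
    show ?thesis
      using bounds(1) bounds(2) der ex by metis
  qed
  show "norm ((slice_deriv ^^ n) f 0) / fact n \<le> 1" using *[OF i_imag_unit] by blast
  show "norm (f (slice_emb I z)) \<le> norm z ^ n" if "I \<in> imag_units" "norm z < 1"
    using *[OF that(1)] that(2) by blast
qed

text \<open>Osserman's lemma for the coordinate in the direction of \<open>f \<xi>\<close>. In the case of equality this coordinate is
  \<open>z ^ n * c\<close> with \<open>norm c = 1\<close>, which exhausts the bound \<open>norm z ^ n\<close> for the norm of \<open>f\<close>; hence the
  part of \<open>f\<close> orthogonal to \<open>f \<xi>\<close> vanishes on the slice, and the identity principle propagates this to the
  whole domain.\<close>

lemma boundary_expr_bounds:
  assumes van: "\<And>k. k < n \<Longrightarrow> (slice_deriv ^^ k) f 0 = 0"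
  defines "s \<equiv> norm ((slice_deriv ^^ n) f 0) / fact n"
    and "t \<equiv> norm ((slice_deriv ^^ Suc n) f 0) / fact (Suc n)"
  shows "1 - s\<^sup>2 + t \<noteq> 0 \<Longrightarrow> quat_ge (boundary_expr \<Omega> \<xi> f) (real n + 2 * (1 - s)\<^sup>2 / (1 - s\<^sup>2 + t))"
    and "\<not> (\<exists>u\<in>sphere 0 1. \<forall>q\<in>\<Omega>. f q = q ^ n * u) \<Longrightarrow> quat_gt (boundary_expr \<Omega> \<xi> f) (real n)"
proof -
  obtain P \<zeta> where P: "P \<in> imag_units" and \<zeta>: "\<xi> = slice_emb P \<zeta>"
    using quat_slice_emb by metis
  define h where "h = (\<lambda>z. slice_coord P (f \<xi>) (f (slice_emb P z)))"
  define lam where "lam = Re (\<zeta> * deriv h \<zeta> * cnj (h \<zeta>))"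
  have lam: "lam = qRe (\<xi> * (slice_deriv f \<xi> * qcnj (f \<xi>)))"
    unfolding lam_def h_def by (rule slice_derivative_tangential(1)[OF P \<zeta>])
  have h\<zeta>: "norm (h \<zeta>) = 1"
    unfolding h_def slice_derivative_tangential(3)[OF P \<zeta>] by simp
  have expr: "boundary_expr \<Omega> \<xi> f = of_real lam"
    unfolding lam by (rule boundary_expr_eq_radial_derivative[OF P \<zeta>])
  have der: "(deriv ^^ k) h 0 = slice_coord P (f \<xi>) ((slice_deriv ^^ k) f 0)" for k
    unfolding h_def using higher_deriv_slice_coord[OF \<Omega>_open f P, of 0 k "f \<xi>"] subsetD[OF ball_sub, of 0] by simp
  have der_le: "norm ((deriv ^^ k) h 0) / fact k \<le> norm ((slice_deriv ^^ k) f 0) / fact k" for k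
    unfolding der using norm_slice_coord_le[OF P, of "f \<xi>"] f_\<xi> by (simp add: divide_right_mono)
  have h0: "(deriv ^^ k) h 0 = 0" if "k < n" for k
    using van[OF that] by (simp add: der)
  have hle: "norm (h z) \<le> 1" if "norm z < 1" for z
    unfolding h_def using norm_coord_le[OF P _ that] f_\<xi> by simp
  have \<zeta>_in: "\<zeta> \<in> slice_emb P -` \<Omega>" using \<xi>_in \<zeta> by simp
  have holh: "h holomorphic_on slice_emb P -` \<Omega>" unfolding h_def by (rule coord_holomorphic[OF P])
  define s0 t0 where "s0 = norm ((deriv ^^ n) h 0) / fact n" and "t0 = norm ((deriv ^^ Suc n) h 0) / fact (Suc n)"
  note osserman = boundary_schwarz_osserman[OF holh open_vimage_slice_emb[OF \<Omega>_open] ball_subset_slice[OF P]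
      hle \<zeta>_in slice_derivative_tangential(4)[OF P \<zeta>] h\<zeta> h0, folded lam_def]
  have lam_ge: "real n \<le> lam" by (rule osserman(1))
  have lam_ge': "real n + 2 * (1 - s0)\<^sup>2 / (1 - s0\<^sup>2 + t0) \<le> lam" if "s0 < 1"
    using that unfolding s0_def t0_def by (rule osserman(2)[rotated -1])
  have lam_eq: "\<exists>c. norm c = 1 \<and> (\<forall>z. norm z < 1 \<longrightarrow> h z = z ^ n * c)" if "lam = real n"
    using that by (rule osserman(3)[rotated -1])
  have s1: "s \<le> 1" unfolding s_def by (rule vanishing_order_bounds(1)[OF van])
  show "quat_ge (boundary_expr \<Omega> \<xi> f) (real n + 2 * (1 - s)\<^sup>2 / (1 - s\<^sup>2 + t))" if "1 - s\<^sup>2 + t \<noteq> 0"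
  proof -
    have "real n + 2 * (1 - s)\<^sup>2 / (1 - s\<^sup>2 + t) \<le> lam"
    \<comment> \<open>For \<open>s = 1\<close> the fraction is \<open>0\<close>; otherwise \<open>s < 1\<close>, and the bound for \<open>h\<close> can be compared with the one for \<open>f\<close>.\<close>
    proof (cases "s = 1")
      case True
      then show ?thesis using lam_ge by simp
    next
      case False
      then have s: "s < 1" using s1 by simp
      have le: "s0 \<le> s" "t0 \<le> t"
        unfolding s0_def s_def t0_def t_def by (rule der_le)+
      have "2 * (1 - s)\<^sup>2 / (1 - s\<^sup>2 + t) \<le> 2 * (1 - s0)\<^sup>2 / (1 - s0\<^sup>2 + t0)"
        by (rule osserman_bound_antimono) (use le s in \<open>auto simp: s0_def t0_def\<close>)
      moreover have "real n + 2 * (1 - s0)\<^sup>2 / (1 - s0\<^sup>2 + t0) \<le> lam"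
        using lam_ge' le(1) s by linarith
      ultimately show ?thesis by linarith
    qed
    then show ?thesis by (simp add: quat_ge_def expr)
  qed
  show "quat_gt (boundary_expr \<Omega> \<xi> f) (real n)"
    if no: "\<not> (\<exists>u\<in>sphere 0 1. \<forall>q\<in>\<Omega>. f q = q ^ n * u)"
  proof -
    have "lam \<noteq> real n"
    proof
      assume "lam = real n"
      then obtain c where c: "norm c = 1" "\<And>z. norm z < 1 \<Longrightarrow> h z = z ^ n * c"
        using lam_eq by blast
      define u where "u = slice_emb P c * f \<xi>"
      have u: "u \<in> sphere 0 1"
        by (simp add: u_def norm_mult norm_slice_emb[OF P] c(1) f_\<xi>)
      have fz: "f (slice_emb P z) = slice_emb P z ^ n * u" if z: "norm z < 1" for z
      proof -
        have "f (slice_emb P z) = slice_emb P (z ^ n * c) * f \<xi>"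
        proof (rule slice_coord_extremal[OF P f_\<xi>])
          show "slice_coord P (f \<xi>) (f (slice_emb P z)) = z ^ n * c"
            using c(2)[OF z] by (simp add: h_def)
          show "norm (f (slice_emb P z)) \<le> norm (z ^ n * c)"
            using vanishing_order_bounds(2)[OF van P z] by (simp add: norm_mult norm_power c(1))
        qed
        then show ?thesis
          by (simp add: u_def slice_emb_mult[OF P] slice_emb_power[OF P] mult.assoc)
      qed
      have "f q = q ^ n * u" if "q \<in> \<Omega>" for q
      proof (rule slice_identity_principle[OF D f slice_regular_monomial[OF \<Omega>_open] _ _ _ _ that])
        show "(0::real) islimpt {- 1<..<1}"
          by (rule interior_limit_point) (simp add: interior_open)
        show "of_real 0 \<in> \<Omega>" using ball_sub by auto
        show "of_real t \<in> \<Omega>" if "t \<in> {- 1<..<1}" for t :: real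
          using ball_sub that by (auto intro!: subsetD[OF ball_sub])
        show "f (of_real t) = of_real t ^ n * u" if "t \<in> {- 1<..<1}" for t :: real
          using fz[of "of_real t"] that by (simp add: abs_less_iff)
      qed
      with u no show False by blast
    qed
    then show ?thesis using lam_ge by (simp add: quat_gt_def expr)
  qed
qed

end

theorem theorem4:
  fixes f :: "quat \<Rightarrow> quat" and \<xi> :: quat and \<Omega> :: "quat set"
  assumes "\<xi> \<in> sphere 0 1"
    and "axially_symmetric_slice_domain \<Omega>"
    and "ball 0 1 \<union> conj_class \<xi> \<subseteq> \<Omega>"
    and "slice_regular_on f \<Omega>"
    and "f ` ball 0 1 \<subseteq> ball 0 1"
    and "f \<xi> \<in> sphere 0 1"
  shows
    "quat_ge (boundary_expr \<Omega> \<xi> f)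
       (2 * (1 - norm (f 0))\<^sup>2 / (1 - (norm (f 0))\<^sup>2 + norm (slice_deriv f 0)))
     \<and>
     (\<forall>n :: nat. (\<forall>k<n. (slice_deriv ^^ k) f 0 = 0) \<longrightarrow>
        (1 - (norm ((slice_deriv ^^ n) f 0 /\<^sub>R fact n))\<^sup>2
             + norm ((slice_deriv ^^ (n + 1)) f 0) / fact (n + 1) \<noteq> 0 \<longrightarrow>
         quat_ge (boundary_expr \<Omega> \<xi> f)
           (real n + 2 * (1 - norm ((slice_deriv ^^ n) f 0) / fact n)\<^sup>2 /
              (1 - (norm ((slice_deriv ^^ n) f 0 /\<^sub>R fact n))\<^sup>2
                 + norm ((slice_deriv ^^ (n + 1)) f 0) / fact (n + 1))))
        \<and>
        (\<not> (\<exists>u\<in>sphere 0 1. \<forall>q\<in>\<Omega>. f q = q ^ n * u) \<longrightarrow>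
         quat_gt (boundary_expr \<Omega> \<xi> f) (real n)))"
proof -
  have "\<xi> \<in> conj_class \<xi>"
    unfolding conj_class_def by (auto intro!: exI[of _ 1])
  then interpret boundary_point f \<xi> \<Omega>
    using assms by unfold_locales auto
  have "norm (f 0) < 1" using f_ball by force
  then have "(norm (f 0))\<^sup>2 < 1" by (simp add: abs_square_less_1)
  then have "1 - (norm (f 0))\<^sup>2 + norm (slice_deriv f 0) \<noteq> 0"
    using norm_ge_zero[of "slice_deriv f 0"] by linarith
  then have 0: "quat_ge (boundary_expr \<Omega> \<xi> f)
       (2 * (1 - norm (f 0))\<^sup>2 / (1 - (norm (f 0))\<^sup>2 + norm (slice_deriv f 0)))"
    using boundary_expr_bounds(1)[of 0] by simp
  have norm_quotient: "norm ((slice_deriv ^^ n) f 0 /\<^sub>R fact n) = norm ((slice_deriv ^^ n) f 0) / fact n" for n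
    by (simp add: divide_inverse mult.commute)
  show ?thesis
    unfolding norm_quotient Suc_eq_plus1[symmetric]
    using 0 boundary_expr_bounds by blast
qed

end
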